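(* Let $T$ be an $\aleph_0$-branching, strongly homogeneous Souslin tree. Then for any given natural number $n>0$, $T$ is isomorphic to the tree product of $n$ strongly homogeneous Souslin trees.
   Context: A tree is a partial order $(T,<_T)$ in which the set of predecessors of every node $t$ is well-ordered by $<_T$; its order type is the height $\mathrm{ht}(t)$ of $t$. $T_\alpha$ is the set of nodes of height $\alpha$, and the height of $T$ is the least $\alpha$ with $T_\alpha=\emptyset$. For $t\in T$, $T(t)=\{s\in T: t\le_T s\}$ with the inherited order. $T$ is $\aleph_0$-splitting ($=\aleph_0$-branching) if every node that is not a leaf has exactly $\aleph_0$ immediate successors. $T$ is normal if: (a) there is a single minimal node (the root); (b) each node $s$ with $\mathrm{ht}(s)+1<\mathrm{ht}\,T$ has at least two immediate successors; (c) each node has successors in every higher non-empty level; (d) nodes of the same limit height with the same set of predecessors are equal. An antichain is a set of pairwise incomparable nodes. A branch is a linearly ordered, downward closed subset. A Souslin tree is a tree of height $\omega_1$ all of whose antichains and all of whose branches are countable. Convention: all Souslin trees are assumed normal and $\aleph_0$-splitting. For trees $T^i$ ($i\in I$) of the same height $\mu$, the tree product is $\bigotimes_{i\in I}T^i=\bigcup_{\alpha<\mu}\prod_{i\in I}T^i_\alpha$ with the coordinatewise tree order. A Souslin tree $T$ is strongly homogeneous if there is a family $(\psi_{st}\mid s,t\in T,\ \mathrm{ht}(s)=\mathrm{ht}(t))$ (a coherent family) such that: (1) $\psi_{st}:T(s)\to T(t)$ is a tree isomorphism and $\psi_{ss}$ is the identity; (2) $\psi_{rt}=\psi_{st}\circ\psi_{rs}$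 for all $r,s,t$ of the same level; (3) if $r,s$ are on the same level, $t$ is above $r$ and $u=\psi_{rs}(t)$, then $\psi_{tu}$ is the restriction of $\psi_{rs}$ to $T(t)$; (4) if $t,u$ are on the same limit level $T_\alpha$, then there is $\gamma<\alpha$ such that for the predecessors $r$ of $t$ and $s$ of $u$ on level $T_\gamma$ we have $\psi_{rs}(t)=u$. *)

theory Defs
  imports Main "HOL-Library.FuncSet" "HOL-Library.Countable_Set"
begin

unbundle cardinal_syntax

text \<open>
  A tree is represented by its reflexive order \<open>R\<close>; its set of nodes is \<open>Field R\<close>.
  Ordinals are represented by well-orders, compared up to order isomorphism by \<open>=o\<close> and \<open><o\<close>.
\<close>

definition is_tree :: "'a rel \<Rightarrow> bool" where
  "is_tree R \<longleftrightarrow> Partial_order R \<and>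
     (\<forall>t\<in>Field R. well_order_on (underS R t) (Restr R (underS R t)))"

definition node_height :: "'a rel \<Rightarrow> 'a \<Rightarrow> 'a rel" where
  "node_height R t = Restr R (underS R t)"

definition level :: "'a rel \<Rightarrow> 'b rel \<Rightarrow> 'a set" where
  "level R \<alpha> = {t \<in> Field R. node_height R t =o \<alpha>}"

text \<open>
  Every ordinal below \<open>\<mu>\<close> is isomorphic to a proper initial segment of \<open>\<mu>\<close>, so
  well-orders on the type of \<open>\<mu>\<close> suffice in the minimality clause.
\<close>

definition has_height :: "'a rel \<Rightarrow> 'b rel \<Rightarrow> bool" where
  "has_height R \<mu> \<longleftrightarrow> Well_order \<mu> \<and> level R \<mu> = {} \<and>
     (\<forall>\<alpha>::'b rel. \<alpha> <o \<mu> \<longrightarrow> level R \<alpha> \<noteq> {})"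

definition limit_ordinal :: "'a rel \<Rightarrow> bool" where
  "limit_ordinal \<alpha> \<longleftrightarrow> Well_order \<alpha> \<and> Field \<alpha> \<noteq> {} \<and> (\<forall>a\<in>Field \<alpha>. aboveS \<alpha> a \<noteq> {})"

definition immediate_succs :: "'a rel \<Rightarrow> 'a \<Rightarrow> 'a set" where
  "immediate_succs R t = {s \<in> aboveS R t. \<not> (\<exists>u \<in> aboveS R t. u \<in> underS R s)}"

definition aleph0_splitting :: "'a rel \<Rightarrow> bool" where
  "aleph0_splitting R \<longleftrightarrow>
     (\<forall>t\<in>Field R. aboveS R t \<noteq> {} \<longrightarrow> |immediate_succs R t| =o natLeq)"

text \<open>
  \<open>Restr R (under R s)\<close> consists of the predecessors of \<open>s\<close> and \<open>s\<close> itself, so its order type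
  is the height of \<open>s\<close> plus one. \<open>\<mu>\<close> is meant to be the height of the tree.
\<close>

definition normal_tree :: "'a rel \<Rightarrow> 'b rel \<Rightarrow> bool" where
  "normal_tree R \<mu> \<longleftrightarrow>
     (\<exists>!t. t \<in> Field R \<and> underS R t = {}) \<and>
     (\<forall>s\<in>Field R. Restr R (under R s) <o \<mu> \<longrightarrow>
        (\<exists>u\<in>immediate_succs R s. \<exists>v\<in>immediate_succs R s. u \<noteq> v)) \<and>
     (\<forall>s\<in>Field R. \<forall>\<alpha>::'a rel. node_height R s <o \<alpha> \<and> level R \<alpha> \<noteq> {} \<longrightarrow>
        (\<exists>u\<in>level R \<alpha>. (s, u) \<in> R)) \<and>
     (\<forall>s\<in>Field R. \<forall>t\<in>Field R. limit_ordinal (node_height R s) \<and>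
        node_height R s =o node_height R t \<and> underS R s = underS R t \<longrightarrow> s = t)"

definition tree_antichain :: "'a rel \<Rightarrow> 'a set \<Rightarrow> bool" where
  "tree_antichain R A \<longleftrightarrow> A \<subseteq> Field R \<and>
     (\<forall>s\<in>A. \<forall>t\<in>A. s \<noteq> t \<longrightarrow> (s, t) \<notin> R \<and> (t, s) \<notin> R)"

definition tree_branch :: "'a rel \<Rightarrow> 'a set \<Rightarrow> bool" where
  "tree_branch R B \<longleftrightarrow> B \<subseteq> Field R \<and> total_on B R \<and> (\<forall>t\<in>B. under R t \<subseteq> B)"

definition omega1 :: "nat set rel" where
  "omega1 = cardSuc natLeq"

text \<open>Souslin trees are normal and \<open>\<aleph>\<^sub>0\<close>-splitting by convention.\<close>

definition souslin_tree :: "'a rel \<Rightarrow> bool" where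
  "souslin_tree R \<longleftrightarrow> is_tree R \<and> has_height R omega1 \<and>
     (\<forall>A. tree_antichain R A \<longrightarrow> countable A) \<and>
     (\<forall>B. tree_branch R B \<longrightarrow> countable B) \<and>
     normal_tree R omega1 \<and> aleph0_splitting R"

definition tree_iso :: "'a rel \<Rightarrow> 'b rel \<Rightarrow> ('a \<Rightarrow> 'b) \<Rightarrow> bool" where
  "tree_iso R S f \<longleftrightarrow> bij_betw f (Field R) (Field S) \<and>
     (\<forall>x\<in>Field R. \<forall>y\<in>Field R. (x, y) \<in> R \<longleftrightarrow> (f x, f y) \<in> S)"

definition isomorphic_trees :: "'a rel \<Rightarrow> 'b rel \<Rightarrow> bool" where
  "isomorphic_trees R S \<longleftrightarrow> (\<exists>f. tree_iso R S f)"

text \<open>\<open>T(t)\<close>: the nodes above or equal to \<open>t\<close>, with the inherited order.\<close>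

definition cone :: "'a rel \<Rightarrow> 'a \<Rightarrow> 'a rel" where
  "cone R t = Restr R (above R t)"

definition same_level :: "'a rel \<Rightarrow> 'a \<Rightarrow> 'a \<Rightarrow> bool" where
  "same_level R s t \<longleftrightarrow> s \<in> Field R \<and> t \<in> Field R \<and> node_height R s =o node_height R t"

text \<open>
  \<open>\<psi> s t\<close> is a total HOL function, but only its values on \<open>above R s\<close>, for \<open>s\<close> and \<open>t\<close> on the
  same level, are constrained.
\<close>

definition coherent_family :: "'a rel \<Rightarrow> ('a \<Rightarrow> 'a \<Rightarrow> 'a \<Rightarrow> 'a) \<Rightarrow> bool" where
  "coherent_family R \<psi> \<longleftrightarrow>
     (\<forall>s t. same_level R s t \<longrightarrow> tree_iso (cone R s) (cone R t) (\<psi> s t)) \<and>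
     (\<forall>s\<in>Field R. \<forall>x\<in>above R s. \<psi> s s x = x) \<and>
     (\<forall>r s t. same_level R r s \<and> same_level R s t \<longrightarrow>
        (\<forall>x\<in>above R r. \<psi> r t x = \<psi> s t (\<psi> r s x))) \<and>
     (\<forall>r s t u. same_level R r s \<and> t \<in> above R r \<and> u = \<psi> r s t \<longrightarrow>
        (\<forall>x\<in>above R t. \<psi> t u x = \<psi> r s x)) \<and>
     (\<forall>t u. same_level R t u \<and> limit_ordinal (node_height R t) \<longrightarrow>
        (\<exists>r\<in>underS R t. \<exists>s\<in>underS R u. same_level R r s \<and> \<psi> r s t = u))"

definition strongly_homogeneous :: "'a rel \<Rightarrow> bool" where
  "strongly_homogeneous R \<longleftrightarrow> (\<exists>\<psi>. coherent_family R \<psi>)"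

text \<open>
  The product of the trees \<open>S i\<close>, \<open>i \<in> I\<close>, of common height \<open>\<mu>\<close>. Its nodes are the families
  whose members all lie on the same level \<open>\<alpha> < \<mu>\<close>.
\<close>

definition tree_prod_nodes :: "'b rel \<Rightarrow> 'i set \<Rightarrow> ('i \<Rightarrow> 'a rel) \<Rightarrow> ('i \<Rightarrow> 'a) set" where
  "tree_prod_nodes \<mu> I S = (\<Union>\<alpha>\<in>{\<alpha>::'b rel. \<alpha> <o \<mu>}. \<Pi>\<^sub>E i\<in>I. level (S i) \<alpha>)"

definition tree_prod :: "'b rel \<Rightarrow> 'i set \<Rightarrow> ('i \<Rightarrow> 'a rel) \<Rightarrow> ('i \<Rightarrow> 'a) rel" where
  "tree_prod \<mu> I S = {(f, g). f \<in> tree_prod_nodes \<mu> I S \<and> g \<in> tree_prod_nodes \<mu> I S \<and>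
     (\<forall>i\<in>I. (f i, g i) \<in> S i)}"

end

theory Submission
  imports Defs
begin

text \<open>
  The idea is to write the nodes of \<open>T\<close> as transfinite sequences of natural numbers and to read
  a natural number as an \<open>n\<close>-tuple.

  Fix one node on every level, enumerate its immediate successors by the natural numbers, and
  carry this enumeration to every other node of the level by the coherent family. A node \<open>t\<close> then
  determines the sequence, of length the height of \<open>t\<close>, of the labels that are met on the way
  from the root to \<open>t\<close>. Nodes are determined by their sequences, since successors
  have different labels and limit nodes are determined by their predecessors; hence the tree order
  is extension of sequences (\<open>seq_order_code\<close>). The coherent family preserves labels,
  which has two consequences. By the limit condition on the family, and
  induction on the height, two sequences of the same length differ at finitely many places
  (\<open>code_coherent\<close>). Conversely, every sequence that differs from one in the tree at finitely many
  places is itself in the tree, because one entry can be changed by passing to another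
  immediate successor and moving along an isomorphism of cones (\<open>code_modify_one\<close>).

  These properties are abstracted in the locale \<open>sequence_system\<close>. They suffice to recover strong
  homogeneity: the isomorphism from the cone of \<open>s\<close> to the cone of \<open>t\<close> replaces the initial segment
  \<open>s\<close> of a sequence by \<open>t\<close>, which is a finite change. Such a tree is also normal and
  \<open>\<aleph>\<^sub>0\<close>-splitting, and it is Souslin as soon as its antichains are countable.

  Now identify the natural numbers with the \<open>n\<close>-tuples of natural numbers. The \<open>i\<close>-th factor
  consists of the sequences of \<open>i\<close>-th components of the sequences in \<open>T\<close>. It inherits the finite
  differences and the closure under finite changes, and an antichain in it lifts to an
  antichain in \<open>T\<close>, so it is a strongly homogeneous Souslin tree (\<open>souslin_factor\<close>). Splitting a
  sequence into its components embeds \<open>T\<close> into the product. This is onto (\<open>components_surj\<close>): given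
  components of sequences \<open>f\<^sub>0, \<dots>, f\<^sub>n\<^sub>-\<^sub>1\<close> of the same length, the sequence assembled from
  them agrees with \<open>f\<^sub>0\<close> wherever all the \<open>f\<^sub>i\<close> agree, that is at all but finitely many
  places, so it belongs to \<open>T\<close>.
\<close>

section \<open>Countable ordinals\<close>

text \<open>
  A type of countable ordinals with its own class-based order makes heights ordinary
  well-ordered values, so that ranks can be compared by \<open><\<close> and induction
  replaces isomorphisms between initial segments.
\<close>

typedef w1 = "Field omega1"
  using Field_cardSuc_not_empty[OF natLeq_Card_order] by (auto simp: omega1_def)

lemma Card_order_omega1: "Card_order omega1"
  by (simp add: omega1_def cardSuc_Card_order natLeq_Card_order)

lemma Well_order_omega1: "Well_order omega1"
  using Card_order_omega1 card_order_on_well_order_on by blast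

instantiation w1 :: wellorder
begin

definition less_eq_w1 :: "w1 \<Rightarrow> w1 \<Rightarrow> bool" where
  "less_eq_w1 x y \<longleftrightarrow> (Rep_w1 x, Rep_w1 y) \<in> omega1"

definition less_w1 :: "w1 \<Rightarrow> w1 \<Rightarrow> bool" where
  "less_w1 x y \<longleftrightarrow> (Rep_w1 x, Rep_w1 y) \<in> omega1 \<and> x \<noteq> y"

instance
proof
  have lin: "Linear_order omega1" and wf: "wf (omega1 - Id)"
    using Well_order_omega1 by (auto simp: well_order_on_def)
  have trans: "trans omega1" and antisym: "antisym omega1"
    and refl: "refl_on (Field omega1) omega1" and total: "total_on (Field omega1) omega1"
    using lin by (auto simp: linear_order_on_def partial_order_on_def preorder_on_def)
  fix x y z :: w1 and P :: "w1 \<Rightarrow> bool" and a :: w1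
  show "x < y \<longleftrightarrow> x \<le> y \<and> \<not> y \<le> x"
    unfolding less_eq_w1_def less_w1_def using antisym Rep_w1_inject
    by (metis antisymD refl refl_onD Rep_w1)
  show "x \<le> x"
    unfolding less_eq_w1_def using refl Rep_w1 by (metis refl_onD)
  show "x \<le> z" if "x \<le> y" "y \<le> z"
    using that trans unfolding less_eq_w1_def by (metis transD)
  show "x = y" if "x \<le> y" "y \<le> x"
    using that antisym Rep_w1_inject unfolding less_eq_w1_def by (metis antisymD)
  show "x \<le> y \<or> y \<le> x"
    unfolding less_eq_w1_def using total Rep_w1[of x] Rep_w1[of y] refl
    unfolding total_on_def refl_on_def by metis
  assume step: "\<And>x. (\<And>y. y < x \<Longrightarrow> P y) \<Longrightarrow> P x"
  have "wf (inv_image (omega1 - Id) Rep_w1)"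
    using wf by (rule wf_inv_image)
  then show "P a"
    by (induction a rule: wf_induct_rule) (auto intro: step simp: less_w1_def Rep_w1_inject)
qed

end

definition w1_order :: "w1 rel" where
  "w1_order = {(x, y). x \<le> y}"

text \<open>
  The ordinal \<open>a\<close> in the representation by well-orders.
\<close>

definition seg :: "w1 \<Rightarrow> w1 rel" where
  "seg a = {(x, y). x \<le> y \<and> y < a}"

lemma Field_w1_order: "Field w1_order = UNIV"
  by (auto simp: w1_order_def Field_def)

lemma Well_order_w1_order: "Well_order w1_order"
proof -
  have "w1_order - Id = {(x, y). x < y}"
    by (auto simp: w1_order_def)
  then have "wf (w1_order - Id)"
    by (simp only: wf)
  moreover have "refl w1_order" "trans w1_order" "antisym w1_order" "total w1_order"
    unfolding refl_on_def trans_def antisym_def total_on_def w1_order_def by auto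
  ultimately show ?thesis
    unfolding well_order_on_def linear_order_on_def partial_order_on_def preorder_on_def
      Field_w1_order by simp
qed

lemma omega1_ordIso_w1_order: "omega1 =o w1_order"
proof -
  have "iso w1_order omega1 Rep_w1"
    unfolding iso_iff2 Field_w1_order
    by (auto simp: w1_order_def less_eq_w1_def bij_betw_def inj_on_def Rep_w1_inject Rep_w1
        image_iff) (metis Rep_w1_cases)
  then have "w1_order =o omega1"
    using Well_order_w1_order Well_order_omega1 by (auto simp: ordIso_def)
  then show ?thesis
    by (rule ordIso_symmetric)
qed

lemma seg_Restr: "seg a = Restr w1_order (underS w1_order a)"
  by (auto simp: seg_def w1_order_def underS_def)

lemma Field_seg: "Field (seg a) = {x. x < a}"
  by (auto simp: seg_def Field_def)

lemma Well_order_seg: "Well_order (seg a)"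
  unfolding seg_Restr by (rule Well_order_Restr[OF Well_order_w1_order])

lemma ordLess_omega1_iff:
  "\<alpha> <o omega1 \<longleftrightarrow> (\<exists>a. \<alpha> =o seg a)"
proof
  assume "\<alpha> <o omega1"
  then have "\<alpha> <o w1_order"
    using omega1_ordIso_w1_order ordLess_ordIso_trans by blast
  then show "\<exists>a. \<alpha> =o seg a"
    using ordLess_iff_ordIso_Restr[OF Well_order_w1_order, of \<alpha>]
    by (auto simp: seg_Restr ordLess_def)
next
  assume "\<exists>a. \<alpha> =o seg a"
  then obtain a where "\<alpha> =o seg a" by blast
  moreover have "seg a <o w1_order"
    using ordIso_reflexive[OF Well_order_seg, of a] unfolding seg_Restr[of a]
    by (intro iffD2[OF ordLess_iff_ordIso_Restr[OF Well_order_w1_order]])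
      (auto simp: Field_w1_order Well_order_seg[unfolded seg_Restr])
  ultimately show "\<alpha> <o omega1"
    using omega1_ordIso_w1_order
    by (meson ordIso_ordLess_trans ordIso_symmetric ordLess_ordIso_trans)
qed

text \<open>
  The levels of a tree of height \<open>omega1\<close> are indexed by well-orders on the carrier type of
  \<open>omega1\<close>, so initial segments of the type of countable ordinals must be copied there.
\<close>

lemma seg_copy: "\<exists>\<alpha> :: nat set rel. \<alpha> <o omega1 \<and> seg a =o \<alpha>"
proof -
  have "seg a <o omega1"
    using ordLess_omega1_iff[of "seg a"] ordIso_reflexive[OF Well_order_seg, of a] by auto
  then obtain x where x: "seg a =o Restr omega1 (underS omega1 x)"
    using ordLess_iff_ordIso_Restr[OF Well_order_omega1 Well_order_seg, of a] by auto
  have "Restr omega1 (underS omega1 x) <o omega1"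
    unfolding ordLess_omega1_iff by (rule exI, rule ordIso_symmetric[OF x])
  with x show ?thesis by blast
qed

lemma seg_ordLess: "a < b \<Longrightarrow> seg a <o seg b"
proof -
  assume "a < b"
  then have "seg a = Restr (seg b) (underS (seg b) a)"
    by (auto simp: seg_def underS_def)
  then have "seg a =o Restr (seg b) (underS (seg b) a)"
    using ordIso_reflexive[OF Well_order_seg, of a] by simp
  moreover have "a \<in> Field (seg b)"
    using \<open>a < b\<close> by (simp add: Field_seg)
  ultimately show ?thesis
    by (intro iffD2[OF ordLess_iff_ordIso_Restr[OF Well_order_seg Well_order_seg]] bexI)
qed

lemma seg_ordLess_iff: "seg a <o seg b \<longleftrightarrow> a < b"
  by (metis seg_ordLess linorder_cases not_ordLess_ordIso ordIso_reflexive Well_order_seg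
      ordLess_transitive ordLess_irreflexive)

lemma seg_ordIso_iff: "seg a =o seg b \<longleftrightarrow> a = b"
  by (metis seg_ordLess linorder_cases not_ordLess_ordIso ordIso_reflexive Well_order_seg
      ordIso_symmetric)

lemma w1_unbounded: "\<exists>b::w1. a < b"
proof -
  have "\<not> finite (Field omega1)"
    using cardSuc_finite[OF natLeq_Card_order] by (simp add: omega1_def Field_natLeq)
  then obtain b where "b \<in> Field omega1" "Rep_w1 a \<noteq> b" "(Rep_w1 a, b) \<in> omega1"
    using infinite_Card_order_limit[OF Card_order_omega1] Rep_w1 by blast
  then show ?thesis
    unfolding less_w1_def by (metis Rep_w1_cases)
qed

definition w1_suc :: "w1 \<Rightarrow> w1" where
  "w1_suc a = (LEAST b. a < b)"

lemma less_w1_suc: "a < w1_suc a"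
  unfolding w1_suc_def using w1_unbounded by (rule LeastI_ex)

lemma w1_suc_le_iff: "w1_suc a \<le> b \<longleftrightarrow> a < b"
  using less_w1_suc by (metis Least_le order_less_le_trans w1_suc_def)

lemma less_w1_suc_iff: "b < w1_suc a \<longleftrightarrow> b \<le> a"
  by (meson linorder_not_less w1_suc_le_iff)

lemma w1_suc_inject: "w1_suc a = w1_suc b \<longleftrightarrow> a = b"
  by (metis order.eq_iff less_w1_suc_iff order_refl less_w1_suc)

lemma w1_cases:
  obtains (least) "\<And>b. \<not> b < a"
  | (suc) b where "a = w1_suc b"
  | (limit) b where "b < a" "\<And>b. b < a \<Longrightarrow> w1_suc b < a"
  by (metis order.not_eq_order_implies_strict w1_suc_le_iff)

section \<open>Trees with a rank function\<close>

text \<open>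
  A partial order with a rank function that maps the predecessors of every node \<open>t\<close> bijectively
  onto the ordinals below \<open>h t\<close>. This is a tree of height \<open>\<omega>\<^sub>1\<close> in which \<open>h\<close> is the height.
\<close>

locale ranked =
  fixes R :: "'a rel" and h :: "'a \<Rightarrow> w1"
  assumes partial_order: "Partial_order R"
    and rank_strict: "(s, t) \<in> R \<Longrightarrow> s \<noteq> t \<Longrightarrow> h s < h t"
    and rank_onto: "t \<in> Field R \<Longrightarrow> a < h t \<Longrightarrow> \<exists>s. (s, t) \<in> R \<and> h s = a"
    and rank_inj: "(s, t) \<in> R \<Longrightarrow> (s', t) \<in> R \<Longrightarrow> h s = h s' \<Longrightarrow> s = s'"
    and rank_surj: "\<exists>t \<in> Field R. h t = a"
begin

lemma R_refl: "t \<in> Field R \<Longrightarrow> (t, t) \<in> R"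
  using partial_order by (auto simp: partial_order_on_def preorder_on_def refl_on_def)

lemma R_trans: "(s, t) \<in> R \<Longrightarrow> (t, u) \<in> R \<Longrightarrow> (s, u) \<in> R"
  using partial_order unfolding partial_order_on_def preorder_on_def by (meson transD)

lemma R_antisym: "(s, t) \<in> R \<Longrightarrow> (t, s) \<in> R \<Longrightarrow> s = t"
  using partial_order unfolding partial_order_on_def by (meson antisymD)

lemma fields: "(s, t) \<in> R \<Longrightarrow> s \<in> Field R" "(s, t) \<in> R \<Longrightarrow> t \<in> Field R"
  by (auto simp: Field_def)

lemma rank_mono: "(s, t) \<in> R \<Longrightarrow> h s \<le> h t"
  using rank_strict by (cases "s = t") (auto simp: less_imp_le)

lemma ex_below: "t \<in> Field R \<Longrightarrow> a \<le> h t \<Longrightarrow> \<exists>s. (s, t) \<in> R \<and> h s = a"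
  using rank_onto R_refl by (cases "a = h t") auto

lemma comparable:
  assumes "(s, t) \<in> R" "(s', t) \<in> R" "h s \<le> h s'"
  shows "(s, s') \<in> R"
proof -
  obtain u where u: "(u, s') \<in> R" "h u = h s"
    using ex_below[OF fields(1)[OF assms(2)] assms(3)] by blast
  have "u = s"
    by (rule rank_inj[OF R_trans[OF u(1) assms(2)] assms(1) u(2)])
  with u show ?thesis by simp
qed

lemma underS_iff: "s \<in> underS R t \<longleftrightarrow> (s, t) \<in> R \<and> h s < h t"
  using rank_strict by (auto simp: underS_def)

lemma rank_image: "t \<in> Field R \<Longrightarrow> h ` underS R t = {a. a < h t}"
  using rank_onto by (force simp: underS_iff)

lemma node_height_iff:
  "(x, y) \<in> node_height R t \<longleftrightarrow> x \<in> underS R t \<and> y \<in> underS R t \<and> h x \<le> h y"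
  unfolding node_height_def Int_iff mem_Sigma_iff underS_iff
  using comparable[of x t y] rank_mono[of x y] by blast

lemma Field_node_height: "Field (node_height R t) = underS R t"
  unfolding Field_def Domain_iff Range_iff set_eq_iff Un_iff node_height_iff by blast

lemma Well_order_node_height: "Well_order (node_height R t)"
proof -
  have "node_height R t - Id \<subseteq> inv_image {(x, y). x < y} h"
    using rank_strict unfolding node_height_def by (clarsimp, blast)
  then have "wf (node_height R t - Id)"
    using wf_subset wf_inv_image wf by metis
  moreover have "h x = h y \<Longrightarrow> x = y" if "x \<in> underS R t" "y \<in> underS R t" for x y
    using that rank_inj[of x t y] unfolding underS_iff by blast
  then have "Linear_order (node_height R t)"
    unfolding linear_order_on_def partial_order_on_def preorder_on_def
      refl_on_def trans_def antisym_def total_on_def Field_node_height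
    by (auto simp: node_height_iff)
  ultimately show ?thesis
    by (simp add: well_order_on_def)
qed

lemma node_height_ordIso: 
  assumes "t \<in> Field R"
  shows "node_height R t =o seg (h t)"
proof -
  have "inj_on h (underS R t)"
    by (rule inj_onI) (use rank_inj in \<open>auto simp: underS_iff\<close>)
  then have "iso (node_height R t) (seg (h t)) h"
    unfolding iso_iff2 Field_node_height Field_seg bij_betw_def rank_image[OF assms]
    by (auto simp: node_height_iff seg_def underS_iff)
  then show ?thesis
    using Well_order_node_height Well_order_seg by (auto simp: ordIso_def)
qed

lemma Field_cone: "Field (cone R s) = above R s"
  using R_refl fields unfolding cone_def above_def Field_def by blast

lemma is_tree: "is_tree R"
  unfolding is_tree_def using partial_order Well_order_node_height Field_node_height
  by (metis node_height_def)

lemma node_height_ordIso_iff: 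
  assumes "t \<in> Field R"
  shows "node_height R t =o \<alpha> \<longleftrightarrow> seg (h t) =o \<alpha>"
  using node_height_ordIso[OF assms] ordIso_transitive[OF ordIso_symmetric] ordIso_transitive
  by metis

lemma same_level_iff: "same_level R s t \<longleftrightarrow> s \<in> Field R \<and> t \<in> Field R \<and> h s = h t"
proof -
  have "node_height R s =o node_height R t \<longleftrightarrow> h s = h t" if "s \<in> Field R" "t \<in> Field R"
    using ordIso_transitive[OF _ node_height_ordIso[OF that(2)]]
      ordIso_transitive[OF _ ordIso_symmetric[OF node_height_ordIso[OF that(2)]]]
    unfolding node_height_ordIso_iff[OF that(1)] seg_ordIso_iff[symmetric] by metis
  then show ?thesis
    by (auto simp: same_level_def)
qed

lemma mem_level_iff: "t \<in> level R \<alpha> \<longleftrightarrow> t \<in> Field R \<and> seg (h t) =o \<alpha>"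
  using node_height_ordIso_iff by (auto simp: level_def)

lemma has_height_omega1: "has_height R omega1"
proof -
  have "level R omega1 = {}"
  proof -
    have "\<not> seg a =o omega1" for a
      by (rule not_ordLess_ordIso[OF iffD2[OF ordLess_omega1_iff]],
          rule exI, rule ordIso_reflexive[OF Well_order_seg])
    then show ?thesis
      unfolding set_eq_iff mem_level_iff by simp
  qed
  moreover have "level R \<alpha> \<noteq> {}" if \<alpha>: "\<alpha> <o omega1" for \<alpha> :: "nat set rel"
  proof -
    obtain a where "\<alpha> =o seg a"
      using \<alpha> ordLess_omega1_iff by blast
    moreover obtain t where "t \<in> Field R" "h t = a"
      using rank_surj by blast
    ultimately have "t \<in> level R \<alpha>"
      by (simp add: mem_level_iff ordIso_symmetric)
    then show ?thesis by blast
  qed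
  ultimately show ?thesis
    unfolding has_height_def using Well_order_omega1 by blast
qed

lemma immediate_succs_iff:
  "s \<in> immediate_succs R t \<longleftrightarrow> (t, s) \<in> R \<and> h s = w1_suc (h t)"
proof 
  assume s: "s \<in> immediate_succs R t"
  then have ts: "(t, s) \<in> R" "s \<noteq> t"
    by (auto simp: immediate_succs_def aboveS_def)
  then have "w1_suc (h t) \<le> h s"
    using rank_strict by (simp add: w1_suc_le_iff)
  moreover have "\<not> w1_suc (h t) < h s"
  proof
    assume less: "w1_suc (h t) < h s"
    then obtain u where u: "(u, s) \<in> R" "h u = w1_suc (h t)"
      using rank_onto fields ts by blast
    then have "(t, u) \<in> R" "h t < h u"
      using comparable[OF ts(1) u(1)] less_w1_suc by (auto simp: less_imp_le)
    then have "u \<in> aboveS R t" "u \<in> underS R s"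
      using u less by (auto simp: aboveS_def underS_def)
    then show False
      using s by (auto simp: immediate_succs_def)
  qed
  ultimately show "(t, s) \<in> R \<and> h s = w1_suc (h t)"
    using ts by simp
next
  assume s: "(t, s) \<in> R \<and> h s = w1_suc (h t)"
  then have "s \<noteq> t"
    using less_w1_suc by (metis order_less_irrefl)
  moreover have "\<not> (u \<in> aboveS R t \<and> u \<in> underS R s)" for u
    using s rank_strict[of t u] by (auto simp: aboveS_def underS_iff less_w1_suc_iff)
  ultimately show "s \<in> immediate_succs R t"
    using s by (auto simp: immediate_succs_def aboveS_def)
qed

lemma limit_ordinal_node_height_iff:
  assumes "t \<in> Field R"
  shows "limit_ordinal (node_height R t) \<longleftrightarrow> (\<exists>b. b < h t) \<and> (\<forall>b<h t. w1_suc b < h t)"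
proof -
  have "(aboveS (node_height R t) s \<noteq> {}) \<longleftrightarrow> w1_suc (h s) < h t" if "s \<in> underS R t" for s
  proof
    assume "aboveS (node_height R t) s \<noteq> {}"
    then obtain u where "(s, u) \<in> R" "s \<noteq> u" "u \<in> underS R t"
      by (auto simp: aboveS_def node_height_def)
    then show "w1_suc (h s) < h t"
      using rank_strict[of s u] w1_suc_le_iff[of "h s" "h u"] by (auto simp: underS_iff)
  next
    assume less: "w1_suc (h s) < h t"
    then obtain u where u: "(u, t) \<in> R" "h u = w1_suc (h s)"
      using rank_onto assms by blast
    then have "h s < h u"
      using less_w1_suc by simp
    then have "u \<in> aboveS (node_height R t) s"
      using that u less by (auto simp: aboveS_def node_height_iff underS_iff)
    then show "aboveS (node_height R t) s \<noteq> {}" by blast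
  qed
  then have "limit_ordinal (node_height R t) \<longleftrightarrow>
      underS R t \<noteq> {} \<and> (\<forall>s \<in> underS R t. w1_suc (h s) < h t)"
    using Well_order_node_height by (auto simp: limit_ordinal_def Field_node_height)
  also have "\<dots> \<longleftrightarrow> h ` underS R t \<noteq> {} \<and> (\<forall>b \<in> h ` underS R t. w1_suc b < h t)"
    by simp
  also have "\<dots> \<longleftrightarrow> (\<exists>b. b < h t) \<and> (\<forall>b<h t. w1_suc b < h t)"
    unfolding rank_image[OF assms] by auto
  finally show ?thesis .
qed

text \<open>
  Choose for every node of the branch an immediate successor off the branch. The chosen
  nodes are pairwise incomparable, because a node below another one would lie on the branch.
\<close>

lemma countable_branch:
  assumes antichains: "\<And>A. tree_antichain R A \<Longrightarrow> countable A"
    and splitting: "\<And>t. t \<in> Field R \<Longrightarrow>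
      \<exists>u \<in> immediate_succs R t. \<exists>v \<in> immediate_succs R t. u \<noteq> v"
    and branch: "tree_branch R B"
  shows "countable B"
proof -
  have B: "B \<subseteq> Field R" "total_on B R" "\<And>t. t \<in> B \<Longrightarrow> under R t \<subseteq> B"
    using branch by (auto simp: tree_branch_def)
  have "\<exists>u. (t, u) \<in> R \<and> h u = w1_suc (h t) \<and> u \<notin> B" if t: "t \<in> B" for t
  proof -
    obtain u v where uv: "(t, u) \<in> R" "h u = w1_suc (h t)" "(t, v) \<in> R" "h v = w1_suc (h t)" "u \<noteq> v"
      using splitting[of t] t B(1) unfolding Bex_def immediate_succs_iff by blast
    then have "\<not> (u \<in> B \<and> v \<in> B)"
      using B(2) rank_strict unfolding total_on_def by (metis order_less_irrefl)
    with uv show ?thesis by blast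
  qed
  then obtain e where e: "\<And>t. t \<in> B \<Longrightarrow> (t, e t) \<in> R \<and> h (e t) = w1_suc (h t) \<and> e t \<notin> B"
    by metis
  have "(e s, e t) \<notin> R" if st: "s \<in> B" "t \<in> B" "e s \<noteq> e t" for s t
  proof
    assume R: "(e s, e t) \<in> R"
    then have "h (e s) \<le> h t"
      using rank_strict[OF R] st e[of t] by (simp add: less_w1_suc_iff)
    then have "(e s, t) \<in> R"
      using comparable[OF R] e st by blast
    then have "e s \<in> B"
      using B(3) st by (auto simp: under_def)
    with e st show False by blast
  qed
  moreover have "e t \<in> Field R" if "t \<in> B" for t
    using e[OF that] fields(2)[of t "e t"] by blast
  ultimately have "tree_antichain R (e ` B)"
    unfolding tree_antichain_def by (simp add: image_subset_iff)
  moreover have "inj_on e B"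
  proof (rule inj_onI)
    fix s t assume st: "s \<in> B" "t \<in> B" "e s = e t"
    then have "h s = h t"
      using e[of s] e[of t] w1_suc_inject by simp
    then show "s = t"
      using e[of s] e[of t] st by (intro rank_inj[of s "e s" t]) simp_all
  qed
  ultimately show ?thesis
    using antichains countable_image_inj_on by blast
qed

end

section \<open>Trees of sequences that are closed under finite changes\<close>

text \<open>
  The sequence attached to a node \<open>t\<close> is the restriction of \<open>f t\<close> to the ordinals below \<open>h t\<close>.
  The nodes are kept abstract, instead of being sequences, because the factors of a tree have to live
  on the type of that tree.
\<close>

locale sequence_system =
  fixes N :: "'a set" and h :: "'a \<Rightarrow> w1" and f :: "'a \<Rightarrow> w1 \<Rightarrow> nat"
  assumes restrict: "t \<in> N \<Longrightarrow> a \<le> h t \<Longrightarrow> \<exists>s \<in> N. h s = a \<and> (\<forall>b<a. f s b = f t b)"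
    and node_eqI: "s \<in> N \<Longrightarrow> t \<in> N \<Longrightarrow> h s = h t \<Longrightarrow> (\<And>b. b < h s \<Longrightarrow> f s b = f t b) \<Longrightarrow> s = t"
    and level_nonempty: "\<exists>t \<in> N. h t = a"
    and coherent: "s \<in> N \<Longrightarrow> t \<in> N \<Longrightarrow> h s = h t \<Longrightarrow> finite {b. b < h s \<and> f s b \<noteq> f t b}"
    and modify: "t \<in> N \<Longrightarrow> finite {b. b < h t \<and> g b \<noteq> f t b} \<Longrightarrow>
      \<exists>s \<in> N. h s = h t \<and> (\<forall>b<h t. f s b = g b)"

definition seq_order :: "'a set \<Rightarrow> ('a \<Rightarrow> w1) \<Rightarrow> ('a \<Rightarrow> w1 \<Rightarrow> nat) \<Rightarrow> 'a rel" where
  "seq_order N h f = {(s, t). s \<in> N \<and> t \<in> N \<and> h s \<le> h t \<and> (\<forall>b<h s. f s b = f t b)}"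

lemma Field_seq_order: "Field (seq_order N h f) = N"
  by (auto simp: seq_order_def Field_def)

sublocale sequence_system \<subseteq> ranked "seq_order N h f" h
proof
  show "Partial_order (seq_order N h f)"
    unfolding partial_order_on_def preorder_on_def Field_seq_order
  proof (intro conjI)
    show "refl_on N (seq_order N h f)" "trans (seq_order N h f)"
      unfolding refl_on_def trans_def seq_order_def by auto
    show "antisym (seq_order N h f)"
      unfolding antisym_def seq_order_def using node_eqI by auto
  qed (auto simp: seq_order_def)
  show "h s < h t" if "(s, t) \<in> seq_order N h f" "s \<noteq> t" for s t
    using that node_eqI[of s t] by (auto simp: seq_order_def order.strict_iff_order)
  show "\<exists>s. (s, t) \<in> seq_order N h f \<and> h s = a" if "t \<in> Field (seq_order N h f)" "a < h t" for t a
    using that(2) restrict[OF that(1)[unfolded Field_seq_order], of a]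
      that(1)[unfolded Field_seq_order] unfolding seq_order_def by (force simp: less_imp_le)
  show "s = s'" if "(s, t) \<in> seq_order N h f" "(s', t) \<in> seq_order N h f" "h s = h s'" for s s' t
    using that by (intro node_eqI) (auto simp: seq_order_def)
  show "\<exists>t \<in> Field (seq_order N h f). h t = a" for a
    using level_nonempty by (simp add: Field_seq_order)
qed

context sequence_system
begin

abbreviation "S \<equiv> seq_order N h f"

text \<open>
  Replacing the initial segment of \<open>x\<close> by \<open>t\<close> is a finite change, since \<open>t\<close> and the
  restriction of \<open>x\<close> to the length of \<open>t\<close> differ at finitely many places.
\<close>

lemma ex_graft:
  assumes "t \<in> N" "x \<in> N" "h t \<le> h x"
  shows "\<exists>y \<in> N. h y = h x \<and> (\<forall>b<h x. f y b = (if b < h t then f t b else f x b))"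
proof (rule modify[OF assms(2)])
  obtain u where u: "u \<in> N" "h u = h t" "\<forall>b<h t. f u b = f x b"
    using restrict[OF assms(2,3)] by blast
  then have "finite {b. b < h t \<and> f t b \<noteq> f u b}"
    using coherent[OF assms(1) u(1)] by simp
  then show "finite {b. b < h x \<and> (if b < h t then f t b else f x b) \<noteq> f x b}"
    by (rule rev_finite_subset) (use u in \<open>auto split: if_splits\<close>)
qed

definition graft :: "'a \<Rightarrow> 'a \<Rightarrow> 'a" where
  "graft t x = (SOME y. y \<in> N \<and> h y = h x \<and>
     (\<forall>b<h x. f y b = (if b < h t then f t b else f x b)))"

lemma graft:
  assumes "t \<in> N" "x \<in> N" "h t \<le> h x"
  shows "graft t x \<in> N" "h (graft t x) = h x"
    "b < h x \<Longrightarrow> f (graft t x) b = (if b < h t then f t b else f x b)"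
  using someI_ex[of "\<lambda>y. y \<in> N \<and> h y = h x \<and>
     (\<forall>b<h x. f y b = (if b < h t then f t b else f x b))"] ex_graft[OF assms]
  unfolding graft_def by blast+

lemma mem_S_iff: "(s, t) \<in> S \<longleftrightarrow> s \<in> N \<and> t \<in> N \<and> h s \<le> h t \<and> (\<forall>b<h s. f s b = f t b)"
  by (simp add: seq_order_def)

lemma graft_above:
  assumes "t \<in> N" "x \<in> N" "h t \<le> h x"
  shows "(t, graft t x) \<in> S"
  using graft[OF assms] assms by (auto simp: mem_S_iff)

lemma graft_eqI:
  assumes "t \<in> N" "x \<in> N" "h t \<le> h x" "(t, y) \<in> S" "h y = h x"
    "\<And>b. h t \<le> b \<Longrightarrow> b < h x \<Longrightarrow> f y b = f x b"
  shows "graft t x = y"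
  using graft[OF assms(1-3)] assms by (intro node_eqI) (auto simp: mem_S_iff)

lemma graft_graft:
  assumes "(s, x) \<in> S" "t \<in> N" "h s = h t"
  shows "graft s (graft t x) = x"
proof -
  have x: "s \<in> N" "x \<in> N" "h t \<le> h x"
    using assms by (auto simp: mem_S_iff)
  show ?thesis
    using graft[OF assms(2) x(2,3)] assms x by (intro graft_eqI) auto
qed

lemma graft_mono:
  assumes "t \<in> N" "h t \<le> h x" "(x, y) \<in> S"
  shows "(graft t x, graft t y) \<in> S"
proof -
  have xy: "x \<in> N" "y \<in> N" "h x \<le> h y" "h t \<le> h y"
    using assms by (auto simp: mem_S_iff)
  show ?thesis
    using graft[OF assms(1) xy(1) assms(2)] graft[OF assms(1) xy(2,4)] assms xy
    by (auto simp: mem_S_iff)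
qed

lemma tree_iso_graft:
  assumes "s \<in> N" "t \<in> N" "h s = h t"
  shows "tree_iso (cone S s) (cone S t) (graft t)"
proof -
  have maps: "graft t x \<in> above S t" "graft s (graft t x) = x"
    if "s \<in> N" "t \<in> N" "h s = h t" "x \<in> above S s" for s t x
  proof -
    have "(s, x) \<in> S" "x \<in> N" "h t \<le> h x"
      using that by (auto simp: above_def mem_S_iff)
    then show "graft t x \<in> above S t" "graft s (graft t x) = x"
      using that graft_above graft_graft by (auto simp: above_def)
  qed
  have "bij_betw (graft t) (above S s) (above S t)"
    by (rule bij_betw_byWitness[of _ "graft s"]) (use maps assms in auto)
  moreover have "(x, y) \<in> cone S s \<longleftrightarrow> (graft t x, graft t y) \<in> cone S t"
    if xy: "x \<in> above S s" "y \<in> above S s" for x y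
  proof -
    have h: "h t \<le> h x" "h t \<le> h y" "x \<in> N" "y \<in> N"
      using xy assms by (auto simp: above_def mem_S_iff)
    have "(x, y) \<in> S \<longleftrightarrow> (graft t x, graft t y) \<in> S"
    proof
      assume "(x, y) \<in> S" 
      then show "(graft t x, graft t y) \<in> S"
        using graft_mono assms h by blast
    next
      assume *: "(graft t x, graft t y) \<in> S" 
      have "(graft s (graft t x), graft s (graft t y)) \<in> S"
        by (rule graft_mono) (use assms h graft * in auto)
      then show "(x, y) \<in> S"
        using maps assms xy by simp
    qed
    then show ?thesis
      using maps assms xy by (auto simp: cone_def)
  qed
  ultimately show ?thesis
    by (simp add: tree_iso_def Field_cone)
qed

text \<open>
  The limit condition is where finiteness of the differences enters: a finite set of places
  below a limit ordinal is bounded below it, and from such a bound \<open>c\<close> on the sequences \<open>t\<close> and \<open>u\<close>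
  agree, so grafting the restriction of \<open>u\<close> to \<open>c\<close> onto \<open>t\<close> gives \<open>u\<close>.
\<close>

lemma coherent_family_graft: "coherent_family S (\<lambda>s t. graft t)"
  unfolding coherent_family_def same_level_iff Field_seq_order
proof (intro conjI allI ballI impI)
  show "tree_iso (cone S s) (cone S t) (graft t)" if "s \<in> N \<and> t \<in> N \<and> h s = h t" for s t
    using that tree_iso_graft by blast
  show "graft s x = x" if "s \<in> N" "x \<in> above S s" for s x
    using that by (intro graft_eqI) (auto simp: above_def mem_S_iff)
  show "graft t x = graft t (graft s x)"
    if "(r \<in> N \<and> s \<in> N \<and> h r = h s) \<and> s \<in> N \<and> t \<in> N \<and> h s = h t" "x \<in> above S r" for r s t x
  proof -
    have x: "s \<in> N" "x \<in> N" "h s \<le> h x" "t \<in> N" "h t \<le> h x" "h t = h s"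
      using that by (auto simp: above_def mem_S_iff)
    show ?thesis
      by (rule graft_eqI[symmetric, OF x(4)])
        (use x graft[OF x(1-3)] graft[OF x(4,2,5)] graft_above[OF x(4,2,5)] in auto)
  qed
  show "graft u x = graft s x" 
    if "(r \<in> N \<and> s \<in> N \<and> h r = h s) \<and> t \<in> above S r \<and> u = graft s t" "x \<in> above S t"
    for r s t u x
  proof -
    have x: "s \<in> N" "x \<in> N" "h s \<le> h x" "t \<in> N" "h t \<le> h x" "h s \<le> h t" "(t, x) \<in> S"
      using that by (auto simp: above_def mem_S_iff)
    have u: "u \<in> N" "h u = h t" "(u, graft s x) \<in> S"
      using that graft[OF x(1,4,6)] graft_mono[OF x(1,6,7)] by auto
    show ?thesis
      by (rule graft_eqI) (use x u graft[OF x(1-3)] in auto)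
  qed
  show "\<exists>r\<in>underS S t. \<exists>s\<in>underS S u. (r \<in> N \<and> s \<in> N \<and> h r = h s) \<and> graft s t = u"
    if tu: "(t \<in> N \<and> u \<in> N \<and> h t = h u) \<and> limit_ordinal (node_height S t)" for t u
  proof -
    have lim: "\<exists>b. b < h t" "\<forall>b<h t. w1_suc b < h t"
      using tu limit_ordinal_node_height_iff[of t] by (auto simp: Field_seq_order)
    define D where "D = {b. b < h t \<and> f t b \<noteq> f u b}"
    have "finite D"
      using coherent tu by (auto simp: D_def)
    have "\<exists>c<h t. \<forall>b \<in> D. b < c"
    proof (cases "D = {}")
      case True
      then show ?thesis using lim by auto
    next
      case False
      then have "w1_suc (Max D) < h t"
        using lim(2) \<open>finite D\<close> Max_in[of D] by (auto simp: D_def)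
      moreover have "b < w1_suc (Max D)" if "b \<in> D" for b
        using that \<open>finite D\<close> by (simp add: less_w1_suc_iff)
      ultimately show ?thesis by blast
    qed
    then obtain c where c: "c < h t" "\<And>b. b < h t \<Longrightarrow> c \<le> b \<Longrightarrow> f t b = f u b"
      unfolding D_def using linorder_not_le by blast
    obtain r s where rs: "(r, t) \<in> S" "h r = c" "(s, u) \<in> S" "h s = c"
      using rank_onto[of t c] rank_onto[of u c] c tu by (auto simp: Field_seq_order)
    then have "graft s t = u"
      using c tu by (intro graft_eqI) (auto simp: mem_S_iff)
    moreover have "r \<in> underS S t" "s \<in> underS S u" "r \<in> N" "s \<in> N"
      using rs c(1) tu unfolding underS_iff by (auto simp: mem_S_iff)
    ultimately show ?thesis
      using rs by (intro bexI conjI) simp_all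
  qed
qed

lemma strongly_homogeneous: "strongly_homogeneous S"
  unfolding strongly_homogeneous_def using coherent_family_graft by blast

text \<open>
  Every label is attained: prolong \<open>t\<close> by one step in any way and change the last entry.
\<close>

lemma bij_betw_immediate_succs:
  assumes "t \<in> N"
  shows "bij_betw (\<lambda>s. f s (h t)) (immediate_succs S t) UNIV"
  unfolding bij_betw_def
proof 
  show "inj_on (\<lambda>s. f s (h t)) (immediate_succs S t)"
  proof (rule inj_onI)
    fix x y assume xy: "x \<in> immediate_succs S t" "y \<in> immediate_succs S t" "f x (h t) = f y (h t)"
    then have x: "(t, x) \<in> S" "h x = w1_suc (h t)" and y: "(t, y) \<in> S" "h y = w1_suc (h t)"
      by (simp_all add: immediate_succs_iff)
    show "x = y"
    proof (rule node_eqI)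
      fix b assume "b < h x"
      then consider "b < h t" | "b = h t"
        using x(2) less_w1_suc_iff order_le_less by metis
      then show "f x b = f y b"
        using x(1) y(1) xy(3) by cases (simp_all add: mem_S_iff)
    qed (use x y in \<open>simp_all add: mem_S_iff\<close>)
  qed
  have "\<exists>s. s \<in> immediate_succs S t \<and> f s (h t) = k" for k
  proof -
    obtain x where x: "x \<in> N" "h x = w1_suc (h t)"
      using level_nonempty by blast
    have le: "h t \<le> h x"
      using x less_w1_suc[of "h t"] by simp
    let ?y = "graft t x"
    note y = graft[OF assms x(1) le] graft_above[OF assms x(1) le]
    have "finite {b. b < h ?y \<and> ((f ?y)(h t := k)) b \<noteq> f ?y b}"
      by (rule finite_subset[of _ "{h t}"]) auto
    then obtain s where s: "s \<in> N" "h s = h ?y" "\<forall>b<h ?y. f s b = ((f ?y)(h t := k)) b"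
      using modify[OF y(1)] by blast
    then have "s \<in> immediate_succs S t" "f s (h t) = k"
      using x y less_w1_suc[of "h t"] unfolding immediate_succs_iff
      by (auto simp: mem_S_iff le)
    then show ?thesis by blast
  qed
  then show "(\<lambda>s. f s (h t)) ` immediate_succs S t = UNIV"
    by (metis (mono_tags, lifting) image_eqI surj_def UNIV_I UNIV_eq_I)
qed

lemma two_immediate_succs:
  assumes "t \<in> N"
  shows "\<exists>u \<in> immediate_succs S t. \<exists>v \<in> immediate_succs S t. u \<noteq> v"
proof -
  have "(\<lambda>s. f s (h t)) ` immediate_succs S t = UNIV"
    using bij_betw_immediate_succs[OF assms] by (simp add: bij_betw_def)
  then obtain u v where "u \<in> immediate_succs S t" "v \<in> immediate_succs S t"
    "f u (h t) = 0" "f v (h t) = 1"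
    by (metis (no_types, lifting) UNIV_I imageE)
  then show ?thesis by force
qed

lemma aleph0_splitting: "aleph0_splitting S"
  unfolding aleph0_splitting_def Field_seq_order
proof (intro ballI impI)
  fix t assume "t \<in> N"
  then show "|immediate_succs S t| =o natLeq"
    using card_of_ordIsoI[OF bij_betw_immediate_succs] ordIso_transitive[OF _ card_of_nat] by auto
qed

lemma normal_tree: "normal_tree S omega1"
  unfolding normal_tree_def Field_seq_order
proof (intro conjI ballI allI impI)
  obtain m :: w1 where m: "\<And>b. \<not> b < m"
    using not_less_Least[of _ "\<lambda>x. True"] by blast
  obtain t where t: "t \<in> N" "h t = m"
    using level_nonempty by blast
  show "\<exists>!t. t \<in> N \<and> underS S t = {}"
  proof (rule ex1I[of _ t])
    show "t \<in> N \<and> underS S t = {}"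
      using t m underS_iff by blast
    show "s = t" if "s \<in> N \<and> underS S s = {}" for s
    proof (rule node_eqI)
      have "\<not> b < h s" for b
        using that rank_onto[of s b] underS_iff by (auto simp: Field_seq_order)
      with m t show "h s = h t" "\<And>b. b < h s \<Longrightarrow> f s b = f t b"
        by (auto simp: not_less order.antisym)
    qed (use t that in auto)
  qed
  show "\<exists>u \<in> immediate_succs S s. \<exists>v \<in> immediate_succs S s. u \<noteq> v" if "s \<in> N" for s
    using two_immediate_succs[OF that] .
  show "\<exists>u \<in> level S \<alpha>. (s, u) \<in> S" 
    if "s \<in> N" and \<alpha>: "node_height S s <o \<alpha> \<and> level S \<alpha> \<noteq> {}" for s and \<alpha> :: "'a rel"
  proof -
    obtain x where x: "x \<in> N" "seg (h x) =o \<alpha>"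
      using \<alpha> unfolding set_eq_iff mem_level_iff Field_seq_order by blast
    have "seg (h s) =o node_height S s"
      using node_height_ordIso[of s] that ordIso_symmetric by (auto simp: Field_seq_order)
    then have "seg (h s) <o seg (h x)"
      using that x by (meson ordIso_ordLess_trans ordLess_ordIso_trans ordIso_symmetric)
    then have le: "h s \<le> h x"
      by (simp add: seg_ordLess_iff)
    then have "graft s x \<in> level S \<alpha>"
      using graft[OF \<open>s \<in> N\<close> x(1) le] x by (auto simp: mem_level_iff Field_seq_order)
    then show ?thesis
      using graft_above[OF \<open>s \<in> N\<close> x(1) le] by blast
  qed
  show "s = t" if "s \<in> N" "t \<in> N"
    "limit_ordinal (node_height S s) \<and> node_height S s =o node_height S t \<and> underS S s = underS S t"
    for s t
  proof (rule node_eqI)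
    show "h s = h t"
      using that same_level_iff[of s t] by (auto simp: same_level_def Field_seq_order)
    fix b assume "b < h s"
    then have "w1_suc b < h s"
      using that limit_ordinal_node_height_iff[of s] by (auto simp: Field_seq_order)
    then obtain r where "(r, s) \<in> S" "h r = w1_suc b"
      using rank_onto[of s] \<open>s \<in> N\<close> by (auto simp: Field_seq_order)
    moreover from this have "(r, t) \<in> S"
      using that \<open>w1_suc b < h s\<close> underS_iff by auto
    ultimately show "f s b = f t b"
      using less_w1_suc[of b] by (auto simp: mem_S_iff)
  qed (use that in auto)
qed

lemma souslin_tree:
  assumes "\<And>A. tree_antichain S A \<Longrightarrow> countable A"
  shows "souslin_tree S"
  unfolding souslin_tree_def
  using assms is_tree has_height_omega1 normal_tree aleph0_splitting countable_branch
    two_immediate_succs by (simp add: Field_seq_order)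

end

section \<open>A strongly homogeneous tree as a tree of sequences\<close>

text \<open>
  The height of a node is a countable ordinal: otherwise \<open>\<omega>\<^sub>1\<close> would be the height of this node or
  of one of its predecessors, but the level \<open>\<omega>\<^sub>1\<close> is empty.
\<close>

lemma ex_rank_function:
  fixes R :: "'a rel"
  assumes tree: "is_tree R" and height: "has_height R omega1"
  shows "\<exists>h. ranked R h"
proof -
  have po: "Partial_order R"
    using tree by (simp add: is_tree_def)
  have trans: "(x, z) \<in> R" if "(x, y) \<in> R" "(y, z) \<in> R" for x y z
    using po that unfolding partial_order_on_def preorder_on_def by (meson transD)
  have antisym: "x = y" if "(x, y) \<in> R" "(y, x) \<in> R" for x y
    using po that unfolding partial_order_on_def by (meson antisymD)
  have nh: "Well_order (node_height R t)" "Field (node_height R t) = underS R t"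
    if "t \<in> Field R" for t
    using tree that well_order_on_Well_order[of "underS R t" "node_height R t"]
    by (auto simp: is_tree_def node_height_def)
  have underS_Field: "s \<in> Field R" if "s \<in> underS R t" for s t
    using that by (auto simp: underS_def Field_def)
  have segment: "Restr (node_height R t) (underS (node_height R t) s) = node_height R s"
    if "s \<in> underS R t" for s t
  proof -
    have "underS (node_height R t) s = underS R s"
      using that trans antisym by (auto simp: node_height_def underS_def)
    moreover have "underS R s \<subseteq> underS R t"
      using that trans antisym by (auto simp: underS_def)
    ultimately show ?thesis
      by (auto simp: node_height_def)
  qed
  have less_iff: "r <o node_height R t \<longleftrightarrow> (\<exists>s \<in> underS R t. r =o node_height R s)"
    if "t \<in> Field R" "Well_order r" for r :: "'b rel" and t
    using ordLess_iff_ordIso_Restr[OF nh(1)[OF that(1)] that(2)] segment nh(2)[OF that(1)]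
    by simp
  have not_omega1: "\<not> node_height R t =o omega1" if "t \<in> Field R" for t
    using height that unfolding has_height_def level_def by blast
  have "node_height R t <o omega1" if t: "t \<in> Field R" for t
  proof (rule ccontr)
    assume "\<not> node_height R t <o omega1"
    then have "omega1 \<le>o node_height R t"
      using nh(1)[OF t] Well_order_omega1 not_ordLess_iff_ordLeq by blast
    then have "omega1 <o node_height R t \<or> omega1 =o node_height R t"
      by (simp add: ordLeq_iff_ordLess_or_ordIso)
    then obtain s where "s \<in> Field R" "omega1 =o node_height R s"
      using less_iff[OF t Well_order_omega1] t underS_Field by metis
    then show False
      using not_omega1 ordIso_symmetric by metis
  qed
  then have "\<exists>a. node_height R t =o seg a" if "t \<in> Field R" for t
    using that by (simp add: ordLess_omega1_iff)
  then obtain h where h: "\<And>t. t \<in> Field R \<Longrightarrow> node_height R t =o seg (h t)"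
    by metis
  have seg_iff: "node_height R t =o r \<longleftrightarrow> seg (h t) =o r" if "t \<in> Field R" for t and r :: "'b rel"
    using h[OF that] by (meson ordIso_symmetric ordIso_transitive)
  have strict: "h s < h t" if "(s, t) \<in> R" "s \<noteq> t" for s t
  proof -
    have st: "s \<in> underS R t" "s \<in> Field R" "t \<in> Field R"
      using that by (auto simp: underS_def Field_def)
    then have "node_height R s <o node_height R t"
      using less_iff[OF st(3) nh(1)[OF st(2)]] ordIso_reflexive[OF nh(1)[OF st(2)]] by blast
    then have "seg (h s) <o seg (h t)"
      using h[OF st(2)] h[OF st(3)]
      by (meson ordIso_ordLess_trans ordIso_symmetric ordLess_ordIso_trans)
    then show ?thesis
      by (simp add: seg_ordLess_iff)
  qed
  have "ranked R h"
  proof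
    show "Partial_order R" by (fact po)
    show "h s < h t" if "(s, t) \<in> R" "s \<noteq> t" for s t
      using strict[OF that] .
    show "\<exists>s. (s, t) \<in> R \<and> h s = a" if t: "t \<in> Field R" and a: "a < h t" for t a
    proof -
      have "seg a <o node_height R t"
        using seg_ordLess[OF a] h[OF t]
        by (meson ordIso_symmetric ordLess_ordIso_trans)
      then obtain s where s: "s \<in> underS R t" "seg a =o node_height R s"
        using less_iff[OF t Well_order_seg] by blast
      then have "seg a =o seg (h s)"
        using h[OF underS_Field[OF s(1)]] ordIso_transitive by metis
      then have "h s = a"
        by (simp add: seg_ordIso_iff)
      with s show ?thesis by (auto simp: underS_def)
    qed
    show "s = s'" if "(s, t) \<in> R" "(s', t) \<in> R" "h s = h s'" for s s' t
    proof (rule ccontr)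
      assume "s \<noteq> s'"
      moreover have "s \<noteq> t" "s' \<noteq> t"
        using that strict \<open>s \<noteq> s'\<close> by (metis order_less_irrefl)+
      ultimately have ss: "s \<in> underS R t" "s' \<in> underS R t"
        using that by (auto simp: underS_def)
      have "t \<in> Field R"
        using that by (auto simp: Field_def)
      then have "total_on (underS R t) (node_height R t)"
        using nh[of t] unfolding well_order_on_def linear_order_on_def by simp
      then have "(s, s') \<in> R \<or> (s', s) \<in> R"
        using ss \<open>s \<noteq> s'\<close> unfolding total_on_def node_height_def by blast
      then show False
        using strict that(3) \<open>s \<noteq> s'\<close> by (metis order_less_irrefl)
    qed
    show "\<exists>t \<in> Field R. h t = a" for a
    proof -
      obtain \<alpha> :: "nat set rel" where \<alpha>: "\<alpha> <o omega1" "seg a =o \<alpha>"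
        using seg_copy by blast
      then obtain t where t: "t \<in> Field R" "node_height R t =o \<alpha>"
        using height unfolding has_height_def level_def by blast
      then have "seg (h t) =o \<alpha>"
        using seg_iff[OF t(1)] by blast
      then have "seg (h t) =o seg a"
        using \<alpha>(2) ordIso_symmetric ordIso_transitive by metis
      with t(1) show ?thesis
        by (auto simp: seg_ordIso_iff)
    qed
  qed
  then show ?thesis by blast
qed

locale homogeneous_tree = ranked T h for T :: "'a rel" and h +
  fixes \<psi> :: "'a \<Rightarrow> 'a \<Rightarrow> 'a \<Rightarrow> 'a"
  assumes normal: "normal_tree T omega1"
    and splitting: "aleph0_splitting T"
    and coherent_family: "coherent_family T \<psi>"
begin

lemma root_unique:
  assumes "s \<in> Field T" "t \<in> Field T" "h s = h t" "\<And>b. \<not> b < h s"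
  shows "s = t"
proof -
  have "underS T s = {}" "underS T t = {}"
    using assms underS_iff by auto
  then show ?thesis
    using normal assms(1,2) unfolding normal_tree_def by blast
qed

lemma limit_eqI:
  assumes "s \<in> Field T" "t \<in> Field T" "h s = h t"
    and "b < h s" "\<And>b. b < h s \<Longrightarrow> w1_suc b < h s"
    and "underS T s = underS T t"
  shows "s = t"
proof -
  have "limit_ordinal (node_height T s)"
    using limit_ordinal_node_height_iff[OF assms(1)] assms by blast
  moreover have "node_height T s =o node_height T t"
    using same_level_iff[of s t] assms by (simp add: same_level_def)
  ultimately show ?thesis
    using normal assms unfolding normal_tree_def by blast
qed

lemma ex_enumeration:
  assumes t: "t \<in> Field T"
  shows "\<exists>e :: 'a \<Rightarrow> nat. bij_betw e (immediate_succs T t) UNIV"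
proof -
  obtain u where u: "u \<in> Field T" "h u = w1_suc (h t)"
    using rank_surj by blast
  have "seg (h t) <o seg (h u)"
    using u less_w1_suc by (simp add: seg_ordLess_iff)
  then have "node_height T t <o node_height T u"
    using node_height_ordIso[OF t] node_height_ordIso[OF u(1)]
    by (meson ordIso_ordLess_trans ordIso_symmetric ordLess_ordIso_trans)
  moreover have "u \<in> level T (node_height T u)"
    using u(1) ordIso_reflexive[OF Well_order_node_height] by (simp add: level_def)
  ultimately obtain v where v: "v \<in> level T (node_height T u)" "(t, v) \<in> T"
    using normal t unfolding normal_tree_def by blast
  have "\<not> node_height T t =o node_height T u"
    using \<open>node_height T t <o node_height T u\<close> not_ordLess_ordIso by blast
  then have "v \<noteq> t"
    using v(1) by (auto simp: level_def)
  then have "aboveS T t \<noteq> {}"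
    using v(2) by (auto simp: aboveS_def)
  then have "|immediate_succs T t| =o natLeq"
    using splitting t by (simp add: aleph0_splitting_def)
  then have "|immediate_succs T t| =o |UNIV :: nat set|"
    using card_of_nat ordIso_symmetric ordIso_transitive by metis
  then show ?thesis
    by (simp add: card_of_ordIso)
qed

lemma psi_iso:
  assumes "s \<in> Field T" "t \<in> Field T" "h s = h t"
  shows "bij_betw (\<psi> s t) (above T s) (above T t)"
    and "(s, x) \<in> T \<Longrightarrow> (s, y) \<in> T \<Longrightarrow> (\<psi> s t x, \<psi> s t y) \<in> T \<longleftrightarrow> (x, y) \<in> T"
    and "(s, x) \<in> T \<Longrightarrow> (t, \<psi> s t x) \<in> T"
proof -
  have iso: "tree_iso (cone T s) (cone T t) (\<psi> s t)"
    using conjunct1[OF coherent_family[unfolded coherent_family_def]] assms same_level_iff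
    by simp
  then show bij: "bij_betw (\<psi> s t) (above T s) (above T t)"
    by (simp add: tree_iso_def Field_cone)
  show "(t, \<psi> s t x) \<in> T" if "(s, x) \<in> T" for x
    using bij_betwE[OF bij] that by (auto simp: above_def)
  note maps = this
  assume xy: "(s, x) \<in> T" "(s, y) \<in> T"
  then have xy': "x \<in> above T s" "y \<in> above T s" "\<psi> s t x \<in> above T t" "\<psi> s t y \<in> above T t"
    using maps by (simp_all add: above_def)
  then have "(x, y) \<in> cone T s \<longleftrightarrow> (\<psi> s t x, \<psi> s t y) \<in> cone T t"
    using iso unfolding tree_iso_def Field_cone by blast
  with xy' show "(\<psi> s t x, \<psi> s t y) \<in> T \<longleftrightarrow> (x, y) \<in> T"
    by (simp add: cone_def)
qed

text \<open>
  By induction on the rank of \<open>x\<close>. If the image of \<open>x\<close> had smaller rank, the predecessor of \<open>x\<close> of that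
  rank would have the same image as \<open>x\<close>. If it had larger rank, its predecessor of the rank of \<open>x\<close>
  would be the image of a node strictly below \<open>x\<close>, which keeps its smaller rank.
\<close>

lemma psi_rank:
  assumes st: "s \<in> Field T" "t \<in> Field T" "h s = h t"
  shows "(s, x) \<in> T \<Longrightarrow> h (\<psi> s t x) = h x"
proof (induction "h x" arbitrary: x rule: less_induct)
  case less
  let ?y = "\<psi> s t x"
  note y = psi_iso(3)[OF st less.prems]
  have rank_x: "h t \<le> h x"
    using rank_mono[OF less.prems] st(3) by simp
  have rank_y: "h t \<le> h ?y"
    using rank_mono[OF y] .
  have inj: "x' = x" if "(s, x') \<in> T" "\<psi> s t x' = ?y" for x'
    using bij_betw_imp_inj_on[OF psi_iso(1)[OF st]] that less.prems
    by (auto simp: inj_on_def above_def)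
  consider "h ?y < h x" | "h x < h ?y" | "h ?y = h x"
    by (rule linorder_cases)
  then show ?case
  proof cases
    case 1
    then obtain x' where x': "(x', x) \<in> T" "h x' = h ?y"
      using rank_onto fields less.prems by blast
    then have sx': "(s, x') \<in> T"
      using comparable[OF less.prems x'(1)] rank_y st(3) by simp
    then have "h (\<psi> s t x') = h ?y"
      using less.hyps[of x'] 1 x'(2) by simp
    moreover have "(\<psi> s t x', ?y) \<in> T"
      using psi_iso(2)[OF st sx' less.prems] x'(1) by simp
    ultimately have "\<psi> s t x' = ?y"
      using rank_strict[of "\<psi> s t x'" ?y] by (cases "\<psi> s t x' = ?y") simp_all
    then have "x' = x"
      by (rule inj[OF sx'])
    then show ?thesis
      using x'(2) by simp
  next
    case 2
    then obtain y' where y': "(y', ?y) \<in> T" "h y' = h x"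
      using rank_onto fields y by blast
    then have "(t, y') \<in> T"
      using comparable[OF y y'(1)] rank_x by simp
    then have "y' \<in> \<psi> s t ` above T s"
      using bij_betw_imp_surj_on[OF psi_iso(1)[OF st]] by (simp add: above_def)
    then obtain x' where x': "(s, x') \<in> T" "\<psi> s t x' = y'"
      by (auto simp: above_def)
    then have "(x', x) \<in> T"
      using psi_iso(2)[OF st x'(1) less.prems] y'(1) by simp
    moreover have "x' \<noteq> x"
      using x' y' 2 by auto
    ultimately have "h x' < h x"
      using rank_strict by blast
    then show ?thesis
      using less.hyps[of x'] x' y' by simp
  qed
qed

lemma psi_comp:
  assumes "r \<in> Field T" "s \<in> Field T" "t \<in> Field T" "h r = h s" "h s = h t" "(r, x) \<in> T"
  shows "\<psi> s t (\<psi> r s x) = \<psi> r t x"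
  by (rule conjunct1[OF conjunct2[OF conjunct2[OF
          coherent_family[unfolded coherent_family_def]]], rule_format, symmetric])
    (simp_all add: assms same_level_iff above_def)

lemma psi_restrict:
  assumes "r \<in> Field T" "s \<in> Field T" "h r = h s" "(r, t) \<in> T" "(t, x) \<in> T"
  shows "\<psi> t (\<psi> r s t) x = \<psi> r s x"
  by (rule conjunct1[OF conjunct2[OF conjunct2[OF conjunct2[OF
          coherent_family[unfolded coherent_family_def]]]], rule_format])
    (simp_all add: assms same_level_iff above_def)

lemma psi_limit:
  assumes "t \<in> Field T" "u \<in> Field T" "h t = h u" 
    and "b < h t" "\<And>b. b < h t \<Longrightarrow> w1_suc b < h t"
  obtains r s where "(r, t) \<in> T" "(s, u) \<in> T" "h r < h t" "h r = h s" "\<psi> r s t = u"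
proof -
  have "limit_ordinal (node_height T t)"
    using limit_ordinal_node_height_iff[OF assms(1)] assms by blast
  then have "\<exists>r\<in>underS T t. \<exists>s\<in>underS T u. same_level T r s \<and> \<psi> r s t = u"
    by (intro conjunct2[OF conjunct2[OF conjunct2[OF conjunct2[OF
          coherent_family[unfolded coherent_family_def]]]], rule_format])
      (simp add: assms(1-3) same_level_iff)
  then obtain r s where "r \<in> underS T t" "s \<in> underS T u" "same_level T r s" "\<psi> r s t = u"
    by blast
  then show thesis
    using that[of r s] by (simp add: underS_iff same_level_iff)
qed

definition ancestor :: "'a \<Rightarrow> w1 \<Rightarrow> 'a" where
  "ancestor t a = (SOME s. (s, t) \<in> T \<and> h s = a)"

lemma ancestor:
  assumes "t \<in> Field T" "a \<le> h t"
  shows "(ancestor t a, t) \<in> T" "h (ancestor t a) = a"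
  using someI_ex[OF ex_below[OF assms]] by (simp_all add: ancestor_def)

lemma ancestor_eqI:
  assumes "(s, t) \<in> T" "h s = a"
  shows "ancestor t a = s"
proof -
  have "t \<in> Field T" "a \<le> h t"
    using assms fields rank_mono by blast+
  then show ?thesis
    using ancestor[of t a] assms rank_inj[of "ancestor t a" t s] by simp
qed

lemma ancestor_below:
  assumes "(s, t) \<in> T" "a \<le> h s"
  shows "ancestor t a = ancestor s a"
  using ancestor[OF fields(1)[OF assms(1)] assms(2)] R_trans assms(1)
  by (intro ancestor_eqI) blast+

definition base :: "w1 \<Rightarrow> 'a" where
  "base a = (SOME t. t \<in> Field T \<and> h t = a)"

lemma base: "base a \<in> Field T" "h (base a) = a"
  using someI_ex[of "\<lambda>t. t \<in> Field T \<and> h t = a"] rank_surj[of a] unfolding base_def by blast+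

definition enumeration :: "w1 \<Rightarrow> 'a \<Rightarrow> nat" where
  "enumeration a = (SOME e. bij_betw e (immediate_succs T (base a)) UNIV)"

lemma enumeration: "bij_betw (enumeration a) (immediate_succs T (base a)) UNIV"
  unfolding enumeration_def using someI_ex[OF ex_enumeration[OF base(1)]] .

text \<open>
  The label, among the successors of the predecessor of \<open>t\<close> of height \<open>b\<close>, of the next node towards
  \<open>t\<close>, read off after transport to the base node of level \<open>b\<close>.
\<close>

definition code :: "'a \<Rightarrow> w1 \<Rightarrow> nat" where
  "code t b = enumeration b (\<psi> (ancestor t b) (base b) (ancestor t (w1_suc b)))"

lemma code_below:
  assumes "(s, t) \<in> T" "b < h s"
  shows "code s b = code t b"
  using assms by (simp add: code_def ancestor_below[OF assms(1)] less_imp_le w1_suc_le_iff)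

lemma code_succ:
  assumes "s \<in> immediate_succs T t"
  shows "code s (h t) = enumeration (h t) (\<psi> t (base (h t)) s)"
proof -
  have s: "(t, s) \<in> T" "h s = w1_suc (h t)"
    using assms by (simp_all add: immediate_succs_iff)
  then have "(s, s) \<in> T"
    using R_refl fields by blast
  then show ?thesis
    using s by (simp add: code_def ancestor_eqI)
qed

lemma code_bij_succs:
  assumes t: "t \<in> Field T"
  shows "bij_betw (\<lambda>s. code s (h t)) (immediate_succs T t) UNIV"
proof -
  let ?b = "base (h t)"
  note iso = psi_iso[OF t base(1) base(2)[symmetric]]
  note rank = psi_rank[OF t base(1) base(2)[symmetric]]
  have "bij_betw (\<psi> t ?b) (immediate_succs T t) (immediate_succs T ?b)"
    unfolding bij_betw_def
  proof
    show "inj_on (\<psi> t ?b) (immediate_succs T t)"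
      by (rule inj_on_subset[OF bij_betw_imp_inj_on[OF iso(1)]])
        (auto simp: immediate_succs_iff above_def)
    show "\<psi> t ?b ` immediate_succs T t = immediate_succs T ?b"
    proof (intro equalityI subsetI)
      fix y assume "y \<in> \<psi> t ?b ` immediate_succs T t"
      then obtain x where "y = \<psi> t ?b x" "(t, x) \<in> T" "h x = w1_suc (h t)"
        unfolding image_iff Bex_def immediate_succs_iff by blast
      then show "y \<in> immediate_succs T ?b"
        using iso(3) rank by (simp add: immediate_succs_iff base)
    next
      fix y assume y: "y \<in> immediate_succs T ?b"
      then have "y \<in> \<psi> t ?b ` above T t"
        using bij_betw_imp_surj_on[OF iso(1)] by (simp add: above_def immediate_succs_iff)
      then obtain x where x: "(t, x) \<in> T" "y = \<psi> t ?b x"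
        by (auto simp: above_def)
      then have "x \<in> immediate_succs T t"
        using y rank[OF x(1)] by (simp add: immediate_succs_iff base)
      with x show "y \<in> \<psi> t ?b ` immediate_succs T t" by blast
    qed
  qed
  then have "bij_betw (enumeration (h t) \<circ> \<psi> t ?b) (immediate_succs T t) UNIV"
    using enumeration bij_betw_trans by blast
  then show ?thesis
    by (rule bij_betw_cong[THEN iffD1, rotated]) (simp add: code_succ)
qed

text \<open>
  Let \<open>p\<close> be the predecessor of \<open>x\<close> of height \<open>b\<close>. By restriction and composition in
  the coherent family, transport from \<open>p\<close> directly to the base node of its level is the same as
  transport through \<open>\<psi> s t p\<close>, so the label is the same.
\<close>

lemma code_psi:
  assumes st: "s \<in> Field T" "t \<in> Field T" "h s = h t" and x: "(s, x) \<in> T"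
    and b: "h s \<le> b" "b < h x"
  shows "code (\<psi> s t x) b = code x b"
proof -
  define p q where "p = ancestor x b" and "q = ancestor x (w1_suc b)"
  have xF: "x \<in> Field T"
    using x fields by blast
  have p: "(p, x) \<in> T" "h p = b" and q: "(q, x) \<in> T" "h q = w1_suc b"
    using ancestor[OF xF] b by (simp_all add: p_def q_def less_imp_le w1_suc_le_iff)
  have sp: "(s, p) \<in> T"
    using comparable[OF x p(1)] p b by simp
  have pq: "(p, q) \<in> T"
    using comparable[OF p(1) q(1)] p q less_w1_suc by (simp add: less_imp_le)
  have sq: "(s, q) \<in> T"
    using R_trans[OF sp pq] .
  let ?p = "\<psi> s t p" and ?q = "\<psi> s t q"
  have "ancestor (\<psi> s t x) b = ?p"
    using psi_iso(2)[OF st sp x] psi_rank[OF st sp] p by (intro ancestor_eqI) simp_all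
  moreover have "ancestor (\<psi> s t x) (w1_suc b) = ?q"
    using psi_iso(2)[OF st sq x] psi_rank[OF st sq] q by (intro ancestor_eqI) simp_all
  moreover have "\<psi> ?p (base b) ?q = \<psi> p (base b) q"
  proof -
    have "?q = \<psi> p ?p q"
      using psi_restrict[OF st sp pq] by simp
    moreover have "\<psi> ?p (base b) (\<psi> p ?p q) = \<psi> p (base b) q"
      using psi_rank[OF st sp] p(2) base fields[OF p(1)] fields[OF psi_iso(3)[OF st sp]] pq
      by (intro psi_comp) simp_all
    ultimately show ?thesis by simp
  qed
  ultimately show ?thesis
    by (simp add: code_def p_def q_def)
qed

lemma code_ancestor: 
  assumes "t \<in> Field T" "a \<le> h t" "b < a"
  shows "code (ancestor t a) b = code t b"
  using code_below[OF ancestor(1)[OF assms(1,2)]] ancestor(2)[OF assms(1,2)] assms(3) by simp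

text \<open>
  By induction the two nodes have the same predecessors of every smaller height. At a
  successor height they are immediate successors of one node with the same label; at
  a limit height normality applies.
\<close>

lemma code_eqI:
  assumes "s \<in> Field T" "t \<in> Field T" "h s = h t" "\<And>b. b < h s \<Longrightarrow> code s b = code t b"
  shows "s = t"
  using assms
proof (induction "h s" arbitrary: s t rule: less_induct)
  case less
  have IH: "ancestor s c = ancestor t c" if c: "c < h s" for c
  proof -
    have cs: "c \<le> h s" "c \<le> h t"
      using c less.prems by simp_all
    note anc = ancestor[OF less.prems(1) cs(1)] ancestor[OF less.prems(2) cs(2)]
    show ?thesis
    proof (rule less.hyps)
      show "code (ancestor s c) b = code (ancestor t c) b" if "b < h (ancestor s c)" for b
        using that anc(2) c less.prems(4) code_ancestor[OF less.prems(1) cs(1)]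
          code_ancestor[OF less.prems(2) cs(2)] by simp
    qed (use anc c fields in auto)
  qed
  show ?case
  proof (cases "h s" rule: w1_cases)
    case least
    then show ?thesis
      using root_unique less.prems by blast
  next
    case (suc b)
    define p where "p = ancestor s b"
    have b: "b < h s"
      using suc less_w1_suc by simp
    have "(p, s) \<in> T" "(p, t) \<in> T" "h p = b"
      using ancestor[OF less.prems(1), of b] ancestor[OF less.prems(2), of b] IH[OF b] b
        less.prems(3) by (simp_all add: p_def)
    then have "p \<in> Field T" "s \<in> immediate_succs T p" "t \<in> immediate_succs T p"
      using fields suc less.prems(3) by (auto simp: immediate_succs_iff)
    moreover have "code s (h p) = code t (h p)"
      using less.prems(4) b \<open>h p = b\<close> by simp
    ultimately show ?thesis
      using bij_betw_imp_inj_on[OF code_bij_succs, of p] unfolding inj_on_def by blast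
  next
    case (limit b)
    have "u \<in> underS T s \<longleftrightarrow> u \<in> underS T t" for u
    proof -
      have "(u, s) \<in> T \<longleftrightarrow> (u, t) \<in> T" if "h u < h s"
        using IH[OF that] ancestor[OF less.prems(1), of "h u"] ancestor[OF less.prems(2), of "h u"]
          ancestor_eqI[of u _ "h u"] that less.prems(3) by (metis less_imp_le)
      then show ?thesis
        using less.prems(3) unfolding underS_iff by auto
    qed
    then show ?thesis
      using limit_eqI[OF less.prems(1-3) limit] by blast
  qed
qed

text \<open>
  A successor step adds at most one place of difference. At a limit height, \<open>s\<close> is moved to \<open>t\<close> by
  some \<open>\<psi> p q\<close>, which preserves all labels from the height of \<open>p\<close> on, so the differences lie
  below that height.
\<close>

lemma code_coherent:
  assumes "s \<in> Field T" "t \<in> Field T" "h s = h t"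
  shows "finite {b. b < h s \<and> code s b \<noteq> code t b}"
  using assms
proof (induction "h s" arbitrary: s t rule: less_induct)
  case less
  show ?case
  proof (cases "h s" rule: w1_cases)
    case least
    then show ?thesis by simp
  next
    case (suc b)
    have b: "b < h s" "b \<le> h s" "b \<le> h t"
      using suc less_w1_suc[of b] less.prems(3) by simp_all
    let ?p = "ancestor s b" and ?q = "ancestor t b"
    note anc = ancestor[OF less.prems(1) b(2)] ancestor[OF less.prems(2) b(3)]
    have "finite {c. c < h ?p \<and> code ?p c \<noteq> code ?q c}"
      using less.hyps[of ?p ?q] anc b fields by auto
    moreover have "{c. c < h s \<and> code s c \<noteq> code t c} \<subseteq>
        insert b {c. c < h ?p \<and> code ?p c \<noteq> code ?q c}"
      using suc anc(2) code_ancestor[OF less.prems(1) b(2)] code_ancestor[OF less.prems(2) b(3)]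
      by (auto simp: less_w1_suc_iff)
    ultimately show ?thesis
      using finite_subset by blast
  next
    case (limit b)
    obtain p q where pq: "(p, s) \<in> T" "(q, t) \<in> T" "h p < h s" "h p = h q" "\<psi> p q s = t"
      using psi_limit[OF less.prems(1-3) limit] by blast
    have "p \<in> Field T" "q \<in> Field T"
      using pq fields by blast+
    then have fin: "finite {c. c < h p \<and> code p c \<noteq> code q c}"
      using less.hyps[of p q] pq by blast
    have "{c. c < h s \<and> code s c \<noteq> code t c} \<subseteq> {c. c < h p \<and> code p c \<noteq> code q c}"
    proof
      fix c assume c: "c \<in> {c. c < h s \<and> code s c \<noteq> code t c}"
      have "c < h p"
        using code_psi[OF \<open>p \<in> Field T\<close> \<open>q \<in> Field T\<close> pq(4,1), of c] c pq(5)
        by (auto simp: not_less[symmetric])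
      then show "c \<in> {c. c < h p \<and> code p c \<noteq> code q c}"
        using c code_below[OF pq(1)] code_below[OF pq(2)] pq(4) by simp
    qed
    then show ?thesis
      using fin finite_subset by blast
  qed
qed

text \<open>
  Let \<open>p\<close> be the predecessor of \<open>t\<close> at height \<open>b\<close> and \<open>q\<close> the next node towards \<open>t\<close>. Take the immediate
  successor \<open>q'\<close> of \<open>p\<close> with the label \<open>k\<close>. The image of \<open>t\<close> under \<open>\<psi> q q'\<close> has
  the labels of \<open>q'\<close> at first and those of \<open>t\<close> afterwards.
\<close>

lemma code_modify_one:
  assumes t: "t \<in> Field T" and b: "b < h t"
  shows "\<exists>s \<in> Field T. h s = h t \<and> (\<forall>c<h t. code s c = (if c = b then k else code t c))"
proof -
  have le: "b \<le> h t" "w1_suc b \<le> h t"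
    using b by (simp_all add: w1_suc_le_iff)
  define p q where "p = ancestor t b" and "q = ancestor t (w1_suc b)"
  have p: "(p, t) \<in> T" "h p = b" and q: "(q, t) \<in> T" "h q = w1_suc b"
    using ancestor[OF t le(1)] ancestor[OF t le(2)] by (simp_all add: p_def q_def)
  have "p \<in> Field T" "q \<in> Field T"
    using p q fields by blast+
  obtain q' where "q' \<in> immediate_succs T p" and k: "code q' b = k"
    using bij_betw_imp_surj_on[OF code_bij_succs[OF \<open>p \<in> Field T\<close>]] p(2)
    by (metis (no_types, lifting) UNIV_I imageE)
  then have q': "(p, q') \<in> T" "h q' = w1_suc b"
    using p(2) by (simp_all add: immediate_succs_iff)
  have qq: "q \<in> Field T" "q' \<in> Field T" "h q = h q'"
    using q' fields \<open>q \<in> Field T\<close> q by auto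
  let ?s = "\<psi> q q' t"
  have s: "(q', ?s) \<in> T" "h ?s = h t"
    using psi_iso(3)[OF qq q(1)] psi_rank[OF qq q(1)] .
  have "code ?s c = (if c = b then k else code t c)" if c: "c < h t" for c
  proof -
    consider "c < b" | "c = b" | "w1_suc b \<le> c"
      using w1_suc_le_iff by (metis linorder_cases)
    then show ?thesis
    proof cases
      case 1
      then have "c < h q'"
        using q' less_w1_suc[of b] by simp
      then have "code ?s c = code q' c"
        using code_below[OF s(1)] by simp
      also have "\<dots> = code p c"
        using code_below[OF q'(1)] p(2) 1 by simp
      also have "\<dots> = code t c"
        using code_below[OF p(1)] p(2) 1 by simp
      finally show ?thesis using 1 by auto
    next
      case 2
      then show ?thesis
        using code_below[OF s(1), of b] q'(2) k less_w1_suc by simp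
    next
      case 3
      then have "c \<noteq> b"
        using less_w1_suc[of b] by auto
      then show ?thesis
        using code_psi[OF qq q(1), of c] 3 q(2) c by simp
    qed
  qed
  then show ?thesis
    using s fields by blast
qed

lemma code_modify_finite:
  assumes "finite D" "t \<in> Field T" "\<And>b. b \<in> D \<Longrightarrow> b < h t"
  shows "\<exists>s \<in> Field T. h s = h t \<and> (\<forall>c<h t. code s c = (if c \<in> D then g c else code t c))"
  using assms
proof (induction D)
  case empty
  then show ?case by auto
next
  case (insert b D)
  then obtain s where s: "s \<in> Field T" "h s = h t"
    "\<And>c. c < h t \<Longrightarrow> code s c = (if c \<in> D then g c else code t c)"
    by blast
  obtain u where "u \<in> Field T" "h u = h s"
    "\<And>c. c < h s \<Longrightarrow> code u c = (if c = b then g b else code s c)"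
    using code_modify_one[OF s(1), of b "g b"] insert.prems s(2) by auto
  then show ?case
    using s by (intro bexI[of _ u]) auto
qed

lemma sequence_system_code: "sequence_system (Field T) h code"
proof
  show "\<exists>s\<in>Field T. h s = a \<and> (\<forall>b<a. code s b = code t b)" if "t \<in> Field T" "a \<le> h t" for t a
    using ancestor[OF that] code_ancestor[OF that] fields by blast
  show "\<exists>s\<in>Field T. h s = h t \<and> (\<forall>b<h t. code s b = g b)"
    if "t \<in> Field T" "finite {b. b < h t \<and> g b \<noteq> code t b}" for t g
    using code_modify_finite[OF that(2,1), of g] by fastforce
qed (use code_eqI rank_surj code_coherent in auto)

lemma seq_order_code: "seq_order (Field T) h code = T"
proof (intro equalityI subrelI)
  fix s t assume "(s, t) \<in> seq_order (Field T) h code"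
  then have st: "s \<in> Field T" "t \<in> Field T" "h s \<le> h t" "\<And>b. b < h s \<Longrightarrow> code s b = code t b"
    by (auto simp: seq_order_def)
  note anc = ancestor[OF st(2,3)]
  have "s = ancestor t (h s)"
    using code_ancestor[OF st(2,3)] st anc fields by (intro code_eqI) auto
  then show "(s, t) \<in> T"
    using anc by simp
next
  fix s t assume "(s, t) \<in> T"
  then show "(s, t) \<in> seq_order (Field T) h code"
    using code_below fields rank_mono by (auto simp: seq_order_def)
qed

end

section \<open>Factors of a tree of sequences\<close>

text \<open>
  \<open>proj i k\<close> is the \<open>i\<close>-th component of the \<open>n\<close>-tuple that is coded by \<open>k\<close>.
\<close>

locale factored_system = sequence_system N h f for N :: "'a set" and h f +
  fixes n :: nat and proj :: "nat \<Rightarrow> nat \<Rightarrow> nat"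
  assumes n_pos: "n > 0"
    and proj_inj: "(\<And>i. i < n \<Longrightarrow> proj i k = proj i l) \<Longrightarrow> k = l"
    and proj_surj: "\<exists>k. \<forall>i<n. proj i k = v i"
begin

text \<open>
  The nodes of the \<open>i\<close>-th factor are the classes of nodes with the same sequence of \<open>i\<close>-th
  components. A class is represented by one of its members, which keeps the factor on the type
  of the given tree.
\<close>

definition rep :: "nat \<Rightarrow> 'a \<Rightarrow> 'a" where
  "rep i t = (SOME s. s \<in> N \<and> h s = h t \<and> (\<forall>b<h t. proj i (f s b) = proj i (f t b)))"

definition factor_nodes :: "nat \<Rightarrow> 'a set" where
  "factor_nodes i = rep i ` N"

definition factor :: "nat \<Rightarrow> 'a rel" where
  "factor i = seq_order (factor_nodes i) h (\<lambda>t b. proj i (f t b))"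

lemma rep:
  assumes "t \<in> N"
  shows "rep i t \<in> N" "h (rep i t) = h t"
    "b < h t \<Longrightarrow> proj i (f (rep i t) b) = proj i (f t b)"
  using someI[of "\<lambda>s. s \<in> N \<and> h s = h t \<and> (\<forall>b<h t. proj i (f s b) = proj i (f t b))" t] assms
  unfolding rep_def by blast+

lemma rep_eqI:
  assumes "h s = h t" "\<And>b. b < h s \<Longrightarrow> proj i (f s b) = proj i (f t b)"
  shows "rep i s = rep i t"
  using assms unfolding rep_def by (intro arg_cong[of _ _ Eps]) auto

lemma rep_in: "t \<in> N \<Longrightarrow> rep i t \<in> factor_nodes i"
  by (simp add: factor_nodes_def)

lemma factor_nodes_sub: "factor_nodes i \<subseteq> N"
  using rep by (auto simp: factor_nodes_def)

lemma rep_id: "t \<in> factor_nodes i \<Longrightarrow> rep i t = t"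
  unfolding factor_nodes_def by (auto intro!: rep_eqI simp: rep)

text \<open>
  For the closure under finite changes, the new components have to be completed to full labels: an
  unchanged component keeps its label, so that the full sequence changes at finitely many places.
\<close>

lemma sequence_system_factor:
  assumes i: "i < n"
  shows "sequence_system (factor_nodes i) h (\<lambda>t b. proj i (f t b))"
proof
  show "\<exists>s\<in>factor_nodes i. h s = a \<and> (\<forall>b<a. proj i (f s b) = proj i (f t b))"
    if t: "t \<in> factor_nodes i" and a: "a \<le> h t" for t a
  proof -
    obtain s where "s \<in> N" "h s = a" "\<forall>b<a. f s b = f t b"
      using restrict[OF _ a] t factor_nodes_sub by blast
    then show ?thesis
      using rep[where t = s and i = i] rep_in[of s i] by (intro bexI[of _ "rep i s"]) auto
  qed
  show "s = t" if "s \<in> factor_nodes i" "t \<in> factor_nodes i" "h s = h t"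
    "\<And>b. b < h s \<Longrightarrow> proj i (f s b) = proj i (f t b)" for s t
    using rep_eqI[of s t i] that rep_id by simp
  show "\<exists>t\<in>factor_nodes i. h t = a" for a
    using level_nonempty[of a] rep rep_in by metis
  show "finite {b. b < h s \<and> proj i (f s b) \<noteq> proj i (f t b)}"
    if "s \<in> factor_nodes i" "t \<in> factor_nodes i" "h s = h t" for s t
  proof (rule finite_subset)
    show "{b. b < h s \<and> proj i (f s b) \<noteq> proj i (f t b)} \<subseteq> {b. b < h s \<and> f s b \<noteq> f t b}"
      by auto
    show "finite {b. b < h s \<and> f s b \<noteq> f t b}"
      using coherent that factor_nodes_sub by blast
  qed
  show "\<exists>s\<in>factor_nodes i. h s = h t \<and> (\<forall>b<h t. proj i (f s b) = g b)"
    if t: "t \<in> factor_nodes i" and fin: "finite {b. b < h t \<and> g b \<noteq> proj i (f t b)}" for t g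
  proof -
    have tN: "t \<in> N"
      using t factor_nodes_sub by blast
    have "\<exists>k. proj i k = g b" for b
      using proj_surj[of "\<lambda>_. g b"] i by blast
    then obtain d where d: "\<And>b. proj i (d b) = g b"
      by metis
    define g' where "g' b = (if g b = proj i (f t b) then f t b else d b)" for b
    have "finite {b. b < h t \<and> g' b \<noteq> f t b}"
      by (rule finite_subset[OF _ fin]) (auto simp: g'_def)
    then obtain s where "s \<in> N" "h s = h t" "\<forall>b<h t. f s b = g' b"
      using modify[OF tN] by blast
    then show ?thesis
      using rep[where t = s and i = i] rep_in[of s i] d
      by (intro bexI[of _ "rep i s"]) (auto simp: g'_def)
  qed
qed

text \<open>
  Comparable nodes of the given tree have comparable sequences of components, so an antichain
  of representatives in the factor is an antichain of the given tree.
\<close>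

lemma souslin_factor:
  assumes i: "i < n" and antichains: "\<And>A. tree_antichain S A \<Longrightarrow> countable A"
  shows "souslin_tree (factor i)" "strongly_homogeneous (factor i)"
proof -
  interpret factor: sequence_system "factor_nodes i" h "\<lambda>t b. proj i (f t b)"
    using sequence_system_factor[OF i] .
  have weaker: "(s, t) \<in> factor i" if "(s, t) \<in> S" "s \<in> factor_nodes i" "t \<in> factor_nodes i" for s t
    using that by (auto simp: factor_def seq_order_def)
  have "countable A" if A: "tree_antichain (factor i) A" for A
  proof (rule antichains)
    have "A \<subseteq> factor_nodes i"
      using A by (simp add: tree_antichain_def factor_def Field_seq_order)
    then show "tree_antichain S A"
      using A weaker factor_nodes_sub[of i] unfolding tree_antichain_def Field_seq_order
      by (meson subset_iff)
  qed
  then show "souslin_tree (factor i)" "strongly_homogeneous (factor i)"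
    using factor.souslin_tree factor.strongly_homogeneous by (simp_all add: factor_def)
qed

lemma mem_level_factor_iff:
  assumes "i < n"
  shows "t \<in> level (factor i) \<alpha> \<longleftrightarrow> t \<in> factor_nodes i \<and> seg (h t) =o \<alpha>"
proof -
  interpret factor: sequence_system "factor_nodes i" h "\<lambda>t b. proj i (f t b)"
    using sequence_system_factor[OF assms] .
  show ?thesis
    using factor.mem_level_iff by (simp add: factor_def Field_seq_order)
qed

lemma product_nodes_iff:
  "v \<in> tree_prod_nodes omega1 {..<n} factor \<longleftrightarrow>
     v \<in> extensional {..<n} \<and> (\<exists>a. \<forall>i<n. v i \<in> factor_nodes i \<and> h (v i) = a)"
proof
  assume "v \<in> tree_prod_nodes omega1 {..<n} factor"
  then obtain \<alpha> :: "nat set rel" where \<alpha>: "\<alpha> <o omega1"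
    and v: "v \<in> (\<Pi>\<^sub>E i\<in>{..<n}. level (factor i) \<alpha>)"
    by (auto simp: tree_prod_nodes_def)
  obtain a where a: "\<alpha> =o seg a"
    using \<alpha> ordLess_omega1_iff by blast
  have "v i \<in> factor_nodes i \<and> h (v i) = a" if "i < n" for i
  proof -
    have "v i \<in> level (factor i) \<alpha>"
      using v that by auto
    then have vi: "v i \<in> factor_nodes i" "seg (h (v i)) =o \<alpha>"
      unfolding mem_level_factor_iff[OF that] by simp_all
    show ?thesis
      using ordIso_transitive[OF vi(2) a] vi(1) by (simp add: seg_ordIso_iff)
  qed
  then show "v \<in> extensional {..<n} \<and> (\<exists>a. \<forall>i<n. v i \<in> factor_nodes i \<and> h (v i) = a)"
    using v by (auto simp: PiE_def)
next
  assume v: "v \<in> extensional {..<n} \<and> (\<exists>a. \<forall>i<n. v i \<in> factor_nodes i \<and> h (v i) = a)"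
  then obtain a where a: "\<And>i. i < n \<Longrightarrow> v i \<in> factor_nodes i \<and> h (v i) = a"
    by blast
  obtain \<alpha> :: "nat set rel" where \<alpha>: "\<alpha> <o omega1" "seg a =o \<alpha>"
    using seg_copy by blast
  have "v i \<in> level (factor i) \<alpha>" if "i < n" for i
    using a[OF that] \<alpha>(2) unfolding mem_level_factor_iff[OF that] by simp
  then have "v \<in> (\<Pi>\<^sub>E i\<in>{..<n}. level (factor i) \<alpha>)"
    using v by (auto simp: PiE_def)
  then show "v \<in> tree_prod_nodes omega1 {..<n} factor"
    using \<alpha>(1) unfolding tree_prod_nodes_def by blast
qed

definition components :: "'a \<Rightarrow> nat \<Rightarrow> 'a" where
  "components t = (\<lambda>i\<in>{..<n}. rep i t)"

lemma factor_rep_iff: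
  assumes "s \<in> N" "t \<in> N"
  shows "(rep i s, rep i t) \<in> factor i \<longleftrightarrow>
    h s \<le> h t \<and> (\<forall>b<h s. proj i (f s b) = proj i (f t b))"
proof -
  have "proj i (f (rep i s) b) = proj i (f (rep i t) b) \<longleftrightarrow> proj i (f s b) = proj i (f t b)"
    if "h s \<le> h t" "b < h s" for b
    using that rep(3)[OF assms(1), of b i] rep(3)[OF assms(2), of b i] by simp
  then show ?thesis
    using rep_in rep assms by (auto simp: factor_def seq_order_def)
qed

lemma components_in: "t \<in> N \<Longrightarrow> components t \<in> tree_prod_nodes omega1 {..<n} factor"
  unfolding product_nodes_iff using rep rep_in by (auto simp: components_def)

lemma components_order_iff:
  assumes "s \<in> N" "t \<in> N"
  shows "(components s, components t) \<in> tree_prod omega1 {..<n} factor \<longleftrightarrow> (s, t) \<in> S"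
proof -
  have "(components s, components t) \<in> tree_prod omega1 {..<n} factor \<longleftrightarrow>
      (\<forall>i<n. (rep i s, rep i t) \<in> factor i)"
    using components_in assms by (auto simp: tree_prod_def components_def)
  also have "\<dots> \<longleftrightarrow> h s \<le> h t \<and> (\<forall>b<h s. \<forall>i<n. proj i (f s b) = proj i (f t b))"
    using n_pos by (auto simp: factor_rep_iff assms)
  also have "\<dots> \<longleftrightarrow> h s \<le> h t \<and> (\<forall>b<h s. f s b = f t b)"
    using proj_inj by metis
  finally show ?thesis
    using assms by (simp add: mem_S_iff)
qed

text \<open>
  The components given by \<open>v\<close> are assembled to a sequence \<open>g\<close>. Where \<open>g\<close> differs from the sequence
  of \<open>v 0\<close>, one of the finitely many sequences of the \<open>v i\<close> differs from it as well, so this is a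
  finite change.
\<close>

lemma components_surj:
  assumes "v \<in> tree_prod_nodes omega1 {..<n} factor"
  shows "v \<in> components ` N"
proof -
  obtain a where ext: "v \<in> extensional {..<n}"
    and v: "\<And>i. i < n \<Longrightarrow> v i \<in> factor_nodes i \<and> h (v i) = a"
    using assms unfolding product_nodes_iff by blast
  have vN: "v i \<in> N" if "i < n" for i
    using v[OF that] factor_nodes_sub by blast
  have "\<exists>k. \<forall>i<n. proj i k = proj i (f (v i) b)" for b
    using proj_surj[of "\<lambda>i. proj i (f (v i) b)"] .
  then obtain g where g: "\<And>b i. i < n \<Longrightarrow> proj i (g b) = proj i (f (v i) b)"
    by metis
  have "finite {b. b < h (v 0) \<and> g b \<noteq> f (v 0) b}"
  proof (rule finite_subset)
    show "{b. b < h (v 0) \<and> g b \<noteq> f (v 0) b} \<subseteq>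
        (\<Union>i<n. {b. b < h (v 0) \<and> f (v 0) b \<noteq> f (v i) b})"
    proof
      fix b assume b: "b \<in> {b. b < h (v 0) \<and> g b \<noteq> f (v 0) b}"
      then obtain i where "i < n" "proj i (g b) \<noteq> proj i (f (v 0) b)"
        using proj_inj[of "g b" "f (v 0) b"] by blast
      then have "f (v 0) b \<noteq> f (v i) b"
        using g by auto
      with b \<open>i < n\<close> show "b \<in> (\<Union>i<n. {b. b < h (v 0) \<and> f (v 0) b \<noteq> f (v i) b})"
        by blast
    qed
    show "finite (\<Union>i<n. {b. b < h (v 0) \<and> f (v 0) b \<noteq> f (v i) b})"
    proof (intro finite_UN_I)
      fix i assume "i \<in> {..<n}"
      then show "finite {b. b < h (v 0) \<and> f (v 0) b \<noteq> f (v i) b}"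
        using coherent[of "v 0" "v i"] vN[of 0] vN[of i] v[of 0] v[of i] n_pos by simp
    qed simp
  qed
  then obtain t where t: "t \<in> N" "h t = h (v 0)" "\<And>b. b < h (v 0) \<Longrightarrow> f t b = g b"
    using modify[OF vN[OF n_pos]] by blast
  have "components t = v"
  proof (rule extensionalityI[of _ "{..<n}"])
    show "components t i = v i" if "i \<in> {..<n}" for i
    proof -
      have i: "i < n"
        using that by simp
      have "rep i t = rep i (v i)"
        using t v[OF i] v[OF n_pos] g[OF i] by (intro rep_eqI) simp_all
      then show ?thesis
        using rep_id v[OF i] i by (simp add: components_def)
    qed
  qed (use ext in \<open>simp_all add: components_def\<close>)
  with t(1) show ?thesis by blast
qed

lemma tree_iso_components: "tree_iso S (tree_prod omega1 {..<n} factor) components"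
proof -
  let ?P = "tree_prod omega1 {..<n} factor"
  have image: "components ` N = tree_prod_nodes omega1 {..<n} factor"
    using components_in components_surj by blast
  have "Field ?P = components ` N"
  proof
    show "Field ?P \<subseteq> components ` N"
      unfolding image by (auto simp: Field_def tree_prod_def)
    have "(components t, components t) \<in> ?P" if "t \<in> N" for t
      using components_order_iff[OF that that] that by (simp add: mem_S_iff)
    then show "components ` N \<subseteq> Field ?P"
      by (auto simp: Field_def)
  qed
  moreover have "inj_on components N"
  proof (rule inj_onI)
    fix s t assume st: "s \<in> N" "t \<in> N" "components s = components t"
    then have "(s, t) \<in> S" "(t, s) \<in> S"
      using components_order_iff[of s t] components_order_iff[of t s]
        components_order_iff[of t t] by (simp_all add: mem_S_iff)
    then show "s = t"
      using R_antisym by blast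
  qed
  ultimately show ?thesis
    using components_order_iff by (simp add: tree_iso_def bij_betw_def Field_seq_order)
qed

end

text \<open>
  The lists of length \<open>n\<close> form a countably infinite set, whose enumeration codes tuples by numbers.
\<close>

lemma ex_projections:
  assumes "n > 0"
  shows "\<exists>proj :: nat \<Rightarrow> nat \<Rightarrow> nat. (\<forall>k l. (\<forall>i<n. proj i k = proj i l) \<longrightarrow> k = l) \<and>
    (\<forall>v. \<exists>k. \<forall>i<n. proj i k = v i)"
proof -
  define L where "L = {xs :: nat list. length xs = n}"
  have "infinite L"
  proof
    assume "finite L"
    moreover have "inj (\<lambda>k :: nat. replicate n k)"
      using assms by (auto simp: inj_def replicate_eq_replicate)
    ultimately have "finite (UNIV :: nat set)"
      by (intro inj_on_finite[of "\<lambda>k. replicate n k" UNIV L]) (auto simp: L_def)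
    then show False by simp
  qed
  then have bij: "bij_betw (from_nat_into L) UNIV L"
    by (intro bij_betw_from_nat_into) auto
  have len: "length (from_nat_into L k) = n" for k
    using bij_betwE[OF bij] by (auto simp: L_def)
  let ?proj = "\<lambda>i k. from_nat_into L k ! i"
  have "k = l" if "\<forall>i<n. ?proj i k = ?proj i l" for k l
  proof -
    have "from_nat_into L k = from_nat_into L l"
      using that len by (intro nth_equalityI) simp_all
    then show ?thesis
      using bij_betw_imp_inj_on[OF bij] by (simp add: inj_on_def)
  qed
  moreover have "\<exists>k. \<forall>i<n. ?proj i k = v i" for v
  proof -
    have "map v [0..<n] \<in> range (from_nat_into L)"
      using bij_betw_imp_surj_on[OF bij] by (simp add: L_def)
    then obtain k where "from_nat_into L k = map v [0..<n]"
      by (metis imageE)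
    then show ?thesis
      by (intro exI[of _ k]) simp
  qed
  ultimately show ?thesis
    by (intro exI[of _ ?proj]) simp
qed

theorem theorem2p6:
  fixes T :: "'a rel" and n :: nat
  assumes "aleph0_splitting T"
    and "souslin_tree T"
    and "strongly_homogeneous T"
    and "n > 0"
  shows "\<exists>S :: nat \<Rightarrow> 'a rel.
           (\<forall>i<n. souslin_tree (S i) \<and> strongly_homogeneous (S i)) \<and>
           isomorphic_trees T (tree_prod omega1 {..<n} S)"
proof -
  obtain h where "ranked T h"
    using ex_rank_function assms(2) unfolding souslin_tree_def by blast
  moreover obtain \<psi> where "coherent_family T \<psi>"
    using assms(3) unfolding strongly_homogeneous_def by blast
  ultimately interpret homogeneous_tree T h \<psi>
    using assms(1,2) by (simp add: homogeneous_tree_def homogeneous_tree_axioms_def souslin_tree_def)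
  obtain proj :: "nat \<Rightarrow> nat \<Rightarrow> nat"
    where proj: "\<And>k l. (\<forall>i<n. proj i k = proj i l) \<Longrightarrow> k = l" "\<And>v. \<exists>k. \<forall>i<n. proj i k = v i"
    using ex_projections[OF assms(4)] by blast
  interpret system: factored_system "Field T" h code n proj
    using sequence_system_code assms(4) proj
    by (simp add: factored_system_def factored_system_axioms_def)
  have "countable A" if "tree_antichain T A" for A
    using assms(2) that by (simp add: souslin_tree_def)
  then have "souslin_tree (system.factor i) \<and> strongly_homogeneous (system.factor i)" if "i < n" for i
    using system.souslin_factor[OF that] by (simp add: seq_order_code)
  moreover have "isomorphic_trees T (tree_prod omega1 {..<n} system.factor)"
    using system.tree_iso_components unfolding isomorphic_trees_def seq_order_code by blast
  ultimately show ?thesis by blast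
qed

end
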